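(* Consider the problem $\min_{x\in X}\{f(x)\equiv g(Ex)+\langle b,x\rangle\}$ under the standing assumptions given in the context, and let $f^*$ be its optimal value. Let $\{x^k\}_{k\ge 1}$ be the sequence generated by the Away Step Conditional Gradient (ASCG) algorithm (described in the context, with stepsizes chosen by exact line search or by the adaptive rule) for solving this problem, using a representation reduction procedure $\mathcal R$ with constant $N$. Then for any $k\ge 1$, $$f(x^k)-f^*\le C\,(1-\alpha^\dagger)^{(k-1)/2},$$ where $$\alpha^\dagger=\min\left\{\frac{\Omega_X^2}{8\rho\kappa D^2N^2},\ \frac12\right\},\qquad \kappa=\theta^2\left(\|b\|D+3GD_E+\frac{2(G^2+1)}{\sigma_g}\right),\qquad C=GD_E+\|b\|D,$$ $\theta$ is the Hoffman constant associated with the matrix $[A^T,E^T,b]^T$, and $\Omega_X$ is the vertex-facet distance of $X$.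
   Context: **Standing assumptions.** $\|\cdot\|$ is the Euclidean norm. $E\in\mathbb R^{q\times n}$, $b\in\mathbb R^n$; $g:\mathbb R^q\to\mathbb R$ is continuously differentiable and strongly convex with parameter $\sigma_g$; $f(x)=g(Ex)+\langle b,x\rangle$ is continuously differentiable and has a Lipschitz continuous gradient with constant $\rho$; $X=\{x\in\mathbb R^n: Ax\le a\}$ is a nonempty compact polyhedral set, for some $A\in\mathbb R^{m\times n}$, $a\in\mathbb R^m$. $A_i$ is the $i$th row of $A$. $V=\mathrm{ext}(X)$ is the set of vertices (extreme points) of $X$. **Constants.** $D=\max_{x,y\in X}\|x-y\|$ is the diameter of $X$, $D_E=\max_{x,y\in X}\|Ex-Ey\|$ is the diameter of $EX$, and $G=\max_{x\in X}\|\nabla g(Ex)\|$. Hoffman constant: $\theta$ is the constant of Hoffman's lemma for the polyhedron $X=\{x: Ax\le a\}$ and affine sets $S=\{x:\tilde Ex=\tilde e\}$ with $\tilde E=[E^T,b]^T$; that lemma says that there is a constant $\theta$, depending only on $A$ and $\tilde E$, such that whenever $X\cap S\ne\emptyset$, every $x\in X$ satisfies $\min_{y\in X\cap S}\|x-y\|\le\theta\|\tilde Ex-\tilde e\|$. With $\mathcal B$ the set of all matrices constructed by taking linearly independent rows from the matrix whose rows are those of $A$, those of $E$, and $b^T$, it is written as $\theta=\max_{B\in\mathcal B}\frac{1}{\lambda_{\min}(BB^T)}$, where $\lambda_{\min}$ denotes the minimal eigenvalue. Vertex-facet distance: let $I(V)=\{i\in\{1,\dots,m\}: A_iv=a_i\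 \forall v\in V\}$. Then $\Omega_X=\zeta/\varphi$, where $$\zeta=\min_{v\in V,\ i\in\{1,\dots,m\}:\ a_i>A_iv}(a_i-A_iv),\qquad \varphi=\max_{i\in\{1,\dots,m\}\setminus I(V)}\|A_i\|.$$ **Vertex linear oracle.** A map $\tilde{\mathcal O}_X:\mathbb R^n\to V$ such that for each $c\in\mathbb R^n$, $\langle c,\tilde{\mathcal O}_X(c)\rangle\le\langle c,x\rangle$ for any $x\in X$. **Representation reduction procedure with constant $N$.** A representation $(U,\mu)$ of a point $x$ consists of a set $U\subseteq V$ and coefficients $\mu$ in the unit simplex of $\mathbb R^{|V|}$ with $x=\sum_{v\in V}\mu_vv$ and $U=\{v\in V:\mu_v>0\}$. The procedure $\mathcal R$ takes a representation $(U,\mu)$ of $x$ and replaces it by a representation $(\tilde U,\tilde\mu)$ of $x$ such that $\tilde U\subseteq U$ and $|\tilde U|\le N$. Two options are considered: the trivial procedure that does not change the representation, with $N=|V|$; and an implementation of Carathéodory's theorem, with $N=n+1$. **ASCG algorithm.** Input: a vertex linear oracle $\tilde{\mathcal O}_X$. Initialize: $x^1\in V$, $\mu^1_{x^1}=1$, $\mu^1_v=0$ for $v\in V\setminus\{x^1\}$, $U^1=\{x^1\}$. For $k=1,2,\dots$: 1. Compute $p^k:=\tilde{\mathcal O}_X(\nabla f(x^k))$. 2. Compute $u^k\in\operatorname{argmax}_{v\in U^k}\langle\nabla f(x^k),v\rangle$. 3. If $\langle\nabla f(x^k),p^k-x^k\rangle\le\langle\nabla f(x^k),x^k-u^k\rangle$,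 set $d^k:=p^k-x^k$ and $\bar\gamma^k:=1$. Otherwise set $d^k:=x^k-u^k$ and $\bar\gamma^k:=\mu^k_{u^k}/(1-\mu^k_{u^k})$. 4. Choose the stepsize $\gamma^k$ by one of the rules: exact line search, $\gamma^k\in\operatorname{argmin}_{0\le\gamma\le\bar\gamma^k}f(x^k+\gamma d^k)$; or adaptive, $\gamma^k=\min\left\{-\frac{\langle\nabla f(x^k),d^k\rangle}{\rho\|d^k\|^2},\bar\gamma^k\right\}\in\operatorname{argmin}_{0\le\gamma\le\bar\gamma^k}\left\{\gamma\langle\nabla f(x^k),d^k\rangle+\gamma^2\frac{\rho}{2}\|d^k\|^2\right\}$. 5. Update $x^{k+1}:=x^k+\gamma^kd^k$. 6. Update the representation as follows. - If $d^k=x^k-u^k$ (away step): set $\mu^{k+1}_v:=\mu^k_v(1+\gamma^k)$ for any $v\in U^k\setminus\{u^k\}$ and $\mu^{k+1}_{u^k}:=\mu^k_{u^k}(1+\gamma^k)-\gamma^k$; if $\mu^{k+1}_{u^k}=0$ (drop step), set $U^{k+1}:=U^k\setminus\{u^k\}$, otherwise $U^{k+1}:=U^k$. - Else ($d^k=p^k-x^k$, forward step): set $\mu^{k+1}_v:=\mu^k_v(1-\gamma^k)$ for any $v\in U^k\setminus\{p^k\}$ and $\mu^{k+1}_{p^k}:=\mu^k_{p^k}(1-\gamma^k)+\gamma^k$; if $\mu^{k+1}_{p^k}=1$, set $U^{k+1}:=\{p^k\}$, otherwise $U^{k+1}:=U^k\cup\{p^k\}$. - Finally replace $(U^{k+1},\mu^{k+1}):=\mathcal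 R(U^{k+1},\mu^{k+1})$.
   Formalization: The constant θ is any number satisfying Hoffman's inequality for X and the matrix [E^T,b]^T; the explicit expression max 1/λ_min(BB^T) is not used, since it scales wrongly and the claimed bound fails for it (e.g. rescaled A and E on the unit simplex). *)

theory Defs
  imports "HOL-Analysis.Analysis"
begin

definition C1_with_gradient :: "('a::real_inner \<Rightarrow> real) \<Rightarrow> ('a \<Rightarrow> 'a) \<Rightarrow> bool" where
  "C1_with_gradient h gradh \<longleftrightarrow> (\<forall>x. GDERIV h x :> gradh x) \<and> continuous_on UNIV gradh"

definition strongly_convex :: "real \<Rightarrow> ('a::real_normed_vector \<Rightarrow> real) \<Rightarrow> bool" where
  "strongly_convex \<sigma> h \<longleftrightarrow> 0 < \<sigma> \<and>
     (\<forall>x y t. 0 \<le> t \<and> t \<le> 1 \<longrightarrow>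
        h (t *\<^sub>R x + (1 - t) *\<^sub>R y)
          \<le> t * h x + (1 - t) * h y - \<sigma> / 2 * t * (1 - t) * (norm (x - y))\<^sup>2)"

definition polyhedron_of :: "real^'n^'m \<Rightarrow> real^'m \<Rightarrow> (real^'n) set" where
  "polyhedron_of A a = {x. A *v x \<le> a}"

definition vertices :: "'a::real_vector set \<Rightarrow> 'a set" where
  "vertices X = {v. v extreme_point_of X}"

(* The matrix [E^T, b]^T: the rows of E are indexed by Some j, the additional row b^T by None. *)
definition append_row :: "real^'n^'q \<Rightarrow> real^'n \<Rightarrow> real^'n^('q option)" where
  "append_row E b = (\<chi> i. case i of Some j \<Rightarrow> row j E | None \<Rightarrow> b)"

(* The inequality of Hoffman's lemma for the polyhedron A x <= a and the affine sets M x = e.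
   X \<inter> S is closed and nonempty, so infdist is the minimum of norm (x - y) over y in X \<inter> S.
   The inequality, not the expression max 1/lambda_min(B B^T), defines the constant: that expression
   does not scale like a Hoffman constant (max 1/sqrt(lambda_min(B B^T)) does) and the inequality
   fails for it in general. *)
definition hoffman_constant ::
    "real^'n^'m \<Rightarrow> real^'m \<Rightarrow> real^'n^'r \<Rightarrow> real \<Rightarrow> bool" where
  "hoffman_constant A a M \<theta> \<longleftrightarrow>
     (\<forall>e. let X = polyhedron_of A a; S = {x. M *v x = e} in
        X \<inter> S \<noteq> {} \<longrightarrow> (\<forall>x\<in>X. infdist x (X \<inter> S) \<le> \<theta> * norm (M *v x - e)))"

(* Min and Max below range over finite sets. These are nonempty unless the polyhedron has at most
   one point; in that case its diameter is 0 and the value of Omega is irrelevant. *)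
definition vertex_facet_zeta :: "real^'n^'m \<Rightarrow> real^'m \<Rightarrow> real" where
  "vertex_facet_zeta A a =
     Min {a $ i - row i A \<bullet> v | v i. v \<in> vertices (polyhedron_of A a) \<and> a $ i > row i A \<bullet> v}"

definition vertex_facet_phi :: "real^'n^'m \<Rightarrow> real^'m \<Rightarrow> real" where
  "vertex_facet_phi A a =
     Max ((\<lambda>i. norm (row i A)) `
       (UNIV - {i. \<forall>v\<in>vertices (polyhedron_of A a). row i A \<bullet> v = a $ i}))"

definition vertex_facet_distance :: "real^'n^'m \<Rightarrow> real^'m \<Rightarrow> real" where
  "vertex_facet_distance A a = vertex_facet_zeta A a / vertex_facet_phi A a"

definition vertex_linear_oracle :: "'a::real_inner set \<Rightarrow> ('a \<Rightarrow> 'a) \<Rightarrow> bool" where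
  "vertex_linear_oracle X lmo \<longleftrightarrow>
     (\<forall>c. lmo c \<in> vertices X \<and> (\<forall>x\<in>X. c \<bullet> lmo c \<le> c \<bullet> x))"

(* Only the values of mu on V matter. *)
definition representation_of ::
    "'a::real_vector set \<Rightarrow> 'a set \<times> ('a \<Rightarrow> real) \<Rightarrow> 'a \<Rightarrow> bool" where
  "representation_of V rep x \<longleftrightarrow> (case rep of (U, \<mu>) \<Rightarrow>
     (\<forall>v\<in>V. 0 \<le> \<mu> v) \<and> (\<Sum>v\<in>V. \<mu> v) = 1 \<and> x = (\<Sum>v\<in>V. \<mu> v *\<^sub>R v) \<and>
     U = {v\<in>V. \<mu> v > 0})"

definition representation_reduction ::
    "'a::real_vector set \<Rightarrow> ('a set \<times> ('a \<Rightarrow> real) \<Rightarrow> 'a set \<times> ('a \<Rightarrow> real)) \<Rightarrow> nat \<Rightarrow> bool" where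
  "representation_reduction V R N \<longleftrightarrow>
     (\<forall>rep x. representation_of V rep x \<longrightarrow>
        representation_of V (R rep) x \<and> fst (R rep) \<subseteq> fst rep \<and> card (fst (R rep)) \<le> N)"

definition exact_line_search ::
    "('a::real_inner \<Rightarrow> real) \<Rightarrow> 'a \<Rightarrow> 'a \<Rightarrow> real \<Rightarrow> real \<Rightarrow> bool" where
  "exact_line_search f x d \<gamma>max \<gamma> \<longleftrightarrow>
     is_arg_min (\<lambda>t. f (x + t *\<^sub>R d)) (\<lambda>t. 0 \<le> t \<and> t \<le> \<gamma>max) \<gamma>"

(* For d = 0 the quotient is 0/0 = 0, so the step is 0; every step gives the same next iterate. *)
definition adaptive_stepsize ::
    "('a::real_inner \<Rightarrow> 'a) \<Rightarrow> real \<Rightarrow> 'a \<Rightarrow> 'a \<Rightarrow> real \<Rightarrow> real \<Rightarrow> bool" where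
  "adaptive_stepsize gradf \<rho> x d \<gamma>max \<gamma> \<longleftrightarrow>
     \<gamma> = min (- (gradf x \<bullet> d) / (\<rho> * (norm d)\<^sup>2)) \<gamma>max \<and>
     is_arg_min (\<lambda>t. t * (gradf x \<bullet> d) + t\<^sup>2 * (\<rho> / 2) * (norm d)\<^sup>2)
       (\<lambda>t. 0 \<le> t \<and> t \<le> \<gamma>max) \<gamma>"

definition away_update ::
    "'a \<Rightarrow> real \<Rightarrow> 'a set \<times> ('a \<Rightarrow> real) \<Rightarrow> 'a set \<times> ('a \<Rightarrow> real)" where
  "away_update u \<gamma> rep = (case rep of (U, \<mu>) \<Rightarrow>
     let \<mu>' = (\<lambda>v. if v = u then \<mu> u * (1 + \<gamma>) - \<gamma>
                    else if v \<in> U then \<mu> v * (1 + \<gamma>) else \<mu> v)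
     in (if \<mu>' u = 0 then U - {u} else U, \<mu>'))"

definition forward_update ::
    "'a \<Rightarrow> real \<Rightarrow> 'a set \<times> ('a \<Rightarrow> real) \<Rightarrow> 'a set \<times> ('a \<Rightarrow> real)" where
  "forward_update p \<gamma> rep = (case rep of (U, \<mu>) \<Rightarrow>
     let \<mu>' = (\<lambda>v. if v = p then \<mu> p * (1 - \<gamma>) + \<gamma>
                    else if v \<in> U then \<mu> v * (1 - \<gamma>) else \<mu> v)
     in (if \<mu>' p = 1 then {p} else U \<union> {p}, \<mu>'))"

(* One iteration, from (x, U, mu) to (x', U', mu').
   The weight mu u cannot be 1 in the away branch: then x = u and the forward test holds. *)
definition ascg_step ::
    "('a::real_inner \<Rightarrow> real) \<Rightarrow> ('a \<Rightarrow> 'a) \<Rightarrow> real \<Rightarrow> ('a \<Rightarrow> 'a) \<Rightarrow>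
     ('a set \<times> ('a \<Rightarrow> real) \<Rightarrow> 'a set \<times> ('a \<Rightarrow> real)) \<Rightarrow>
     'a \<Rightarrow> 'a set \<Rightarrow> ('a \<Rightarrow> real) \<Rightarrow> 'a \<Rightarrow> 'a set \<Rightarrow> ('a \<Rightarrow> real) \<Rightarrow> bool" where
  "ascg_step f gradf \<rho> lmo R x U \<mu> x' U' \<mu>' \<longleftrightarrow>
     (\<exists>p u fwd d \<gamma>max \<gamma>.
        p = lmo (gradf x) \<and>
        is_arg_max (\<lambda>v. gradf x \<bullet> v) (\<lambda>v. v \<in> U) u \<and>
        (fwd \<longleftrightarrow> gradf x \<bullet> (p - x) \<le> gradf x \<bullet> (x - u)) \<and>
        d = (if fwd then p - x else x - u) \<and>
        \<gamma>max = (if fwd then 1 else \<mu> u / (1 - \<mu> u)) \<and>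
        (exact_line_search f x d \<gamma>max \<gamma> \<or> adaptive_stepsize gradf \<rho> x d \<gamma>max \<gamma>) \<and>
        x' = x + \<gamma> *\<^sub>R d \<and>
        (U', \<mu>') = R (if fwd then forward_update p \<gamma> (U, \<mu>) else away_update u \<gamma> (U, \<mu>)))"

(* Sequences start at index 1; their values at 0 are unconstrained. *)
definition ascg_sequence ::
    "'a::real_inner set \<Rightarrow> ('a \<Rightarrow> real) \<Rightarrow> ('a \<Rightarrow> 'a) \<Rightarrow> real \<Rightarrow> ('a \<Rightarrow> 'a) \<Rightarrow>
     ('a set \<times> ('a \<Rightarrow> real) \<Rightarrow> 'a set \<times> ('a \<Rightarrow> real)) \<Rightarrow>
     (nat \<Rightarrow> 'a) \<Rightarrow> (nat \<Rightarrow> 'a set) \<Rightarrow> (nat \<Rightarrow> 'a \<Rightarrow> real) \<Rightarrow> bool" where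
  "ascg_sequence X f gradf \<rho> lmo R x U \<mu> \<longleftrightarrow>
     x 1 \<in> vertices X \<and> \<mu> 1 (x 1) = 1 \<and> (\<forall>v\<in>vertices X - {x 1}. \<mu> 1 v = 0) \<and> U 1 = {x 1} \<and>
     (\<forall>k\<ge>1. ascg_step f gradf \<rho> lmo R (x k) (U k) (\<mu> k) (x (Suc k)) (U (Suc k)) (\<mu> (Suc k)))"

end

theory Submission
  imports Defs
begin

text \<open>Three estimates combine. Hoffman's lemma and strong convexity of \<open>g\<close> bound the squared distance
  from \<open>x\<close> to the solution set by \<open>\<kappa>\<close> times the optimality gap \<open>f x - fopt\<close>. For a representation of
  \<open>x\<close> supported on \<open>U\<close>, the polyhedral geometry bounds the pairwise gap \<open>\<nabla>f(x) \<bullet> (u - p)\<close> from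
  below by \<open>\<Omega> / |U|\<close> times the slope of \<open>f\<close> towards the nearest solution; together, the squared
  pairwise gap is at least a multiple of the optimality gap. As the chosen direction has slope at most
  minus half the pairwise gap, a step that is not cut off by its maximal stepsize contracts the
  optimality gap by the factor \<open>1 - \<alpha>\<close>. Away steps that are cut off remove a vertex from \<open>U\<close>, while
  other steps add at most one, so at least half of all steps contract.\<close>

section \<open>Calculus along a line, and the decrease guaranteed by the stepsize rules\<close>

lemma GDERIV_line:
  fixes f :: "'a::real_inner \<Rightarrow> real"
  assumes "GDERIV f (x + t *\<^sub>R d) :> g"
  shows "DERIV (\<lambda>t. f (x + t *\<^sub>R d)) t :> g \<bullet> d"
proof -
  have "((\<lambda>t. x + t *\<^sub>R d) has_derivative (\<lambda>h. h *\<^sub>R d)) (at t)"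
    by (auto intro!: derivative_eq_intros)
  from has_derivative_compose[OF this, of f "\<lambda>h. h \<bullet> g"] assms
  have "((\<lambda>t. f (x + t *\<^sub>R d)) has_derivative (\<lambda>h. (h *\<^sub>R d) \<bullet> g)) (at t)"
    by (simp add: gderiv_def)
  moreover have "(\<lambda>h. (h *\<^sub>R d) \<bullet> g) = (*) (g \<bullet> d)"
    by (simp add: fun_eq_iff inner_commute)
  ultimately show ?thesis by (simp add: has_field_derivative_def)
qed

text \<open>Along the segment from \<open>x\<close> to \<open>x + d\<close>, the derivative of
  \<open>f\<close> minus its quadratic model is nonpositive by Cauchy-Schwarz and the Lipschitz
  bound on the gradient.\<close>

lemma descent_lemma:
  fixes f :: "'a::real_inner \<Rightarrow> real"
  assumes grad: "\<And>x. GDERIV f x :> gradf x" and lip: "\<rho>-lipschitz_on UNIV gradf"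
  shows "f (x + d) \<le> f x + gradf x \<bullet> d + \<rho> / 2 * (norm d)\<^sup>2"
proof -
  define h where "h t = f (x + t *\<^sub>R d) - t * (gradf x \<bullet> d) - t\<^sup>2 * (\<rho> / 2 * (norm d)\<^sup>2)" for t
  have "h 1 \<le> h 0"
  proof (rule DERIV_nonpos_imp_nonincreasing[of 0 1 h])
    fix t :: real assume t: "0 \<le> t" "t \<le> 1"
    have "DERIV h t :> gradf (x + t *\<^sub>R d) \<bullet> d - gradf x \<bullet> d - 2 * t * (\<rho> / 2 * (norm d)\<^sup>2)"
      unfolding h_def
      by (rule derivative_eq_intros GDERIV_line grad refl)+ simp
    moreover have "gradf (x + t *\<^sub>R d) \<bullet> d - gradf x \<bullet> d - 2 * t * (\<rho> / 2 * (norm d)\<^sup>2) \<le> 0"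
    proof -
      have "(gradf (x + t *\<^sub>R d) - gradf x) \<bullet> d \<le> norm (gradf (x + t *\<^sub>R d) - gradf x) * norm d"
        by (rule norm_cauchy_schwarz)
      also have "\<dots> \<le> (\<rho> * norm (t *\<^sub>R d)) * norm d"
        using lipschitz_on_normD[OF lip, of "x + t *\<^sub>R d" x] by (intro mult_right_mono) auto
      finally show ?thesis using t by (simp add: inner_diff_left power2_eq_square algebra_simps)
    qed
    ultimately show "\<exists>y. DERIV h t :> y \<and> y \<le> 0" by blast
  qed simp
  then show ?thesis by (simp add: h_def)
qed

text \<open>Divide \<open>conv\<close> by \<open>t\<close> and let \<open>t\<close> tend to 0 from
  the right. The modulus is an arbitrary number \<open>q\<close> because the composite objective has
  curvature only through \<open>E\<close>: there \<open>q\<close> will be a multiple of the squared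
  norm of \<open>E *v y - E *v x\<close>.\<close>

lemma strong_convexity_first_order:
  fixes f :: "'a::real_inner \<Rightarrow> real"
  assumes grad: "GDERIV f x :> g"
    and conv: "\<And>t. 0 \<le> t \<Longrightarrow> t \<le> 1 \<Longrightarrow>
      f (x + t *\<^sub>R (y - x)) \<le> f x + t * (f y - f x) - t * (1 - t) * q"
  shows "g \<bullet> (y - x) + q \<le> f y - f x"
proof -
  have "DERIV (\<lambda>t. f (x + t *\<^sub>R (y - x))) 0 :> g \<bullet> (y - x)"
    using grad by (intro GDERIV_line) simp
  then have "((\<lambda>t. (f (x + t *\<^sub>R (y - x)) - f x) / t) \<longlongrightarrow> g \<bullet> (y - x)) (at_right 0)"
    by (simp add: DERIV_def filterlim_at_split)
  moreover have "((\<lambda>t. f y - f x - (1 - t) * q) \<longlongrightarrow> f y - f x - (1 - 0) * q) (at_right 0)"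
    by (intro tendsto_intros)
  moreover have "\<forall>\<^sub>F t in at_right 0. (f (x + t *\<^sub>R (y - x)) - f x) / t \<le> f y - f x - (1 - t) * q"
  proof (rule eventually_at_rightI[of 0 1])
    fix t :: real assume t: "t \<in> {0<..<1}"
    then have "f (x + t *\<^sub>R (y - x)) - f x \<le> t * (f y - f x - (1 - t) * q)"
      using conv[of t] by (simp add: algebra_simps)
    then show "(f (x + t *\<^sub>R (y - x)) - f x) / t \<le> f y - f x - (1 - t) * q"
      using t by (simp add: divide_le_eq mult.commute)
  qed simp
  ultimately have "g \<bullet> (y - x) \<le> f y - f x - (1 - 0) * q"
    by (intro tendsto_le[OF trivial_limit_at_right_real]) auto
  then show ?thesis by simp
qed

text \<open>A stepsize strictly below \<open>\<gamma>max\<close> is not cut off, and by convexity it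
  then minimizes over the whole ray. Hence the model bound may be evaluated even at \<open>t\<close>
  beyond \<open>\<gamma>max\<close>, in particular at the unconstrained minimizer of the
  model.\<close>

lemma step_rule_decrease:
  fixes f :: "'a::real_inner \<Rightarrow> real"
  assumes grad: "\<And>x. GDERIV f x :> gradf x" and lip: "\<rho>-lipschitz_on UNIV gradf"
    and conv: "convex_on UNIV f"
    and rule: "exact_line_search f x d \<gamma>max \<gamma> \<or> adaptive_stepsize gradf \<rho> x d \<gamma>max \<gamma>"
  shows "0 \<le> \<gamma>" "\<gamma> \<le> \<gamma>max"
    and "\<And>t. 0 \<le> t \<Longrightarrow> t \<le> \<gamma>max \<or> \<gamma> < \<gamma>max \<Longrightarrow>
      f (x + \<gamma> *\<^sub>R d) \<le> f x + t * (gradf x \<bullet> d) + t\<^sup>2 * (\<rho> / 2) * (norm d)\<^sup>2"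
proof -
  show *: "0 \<le> \<gamma>" "\<gamma> \<le> \<gamma>max"
    using rule by (auto simp: exact_line_search_def adaptive_stepsize_def is_arg_min_def)
  have rho: "0 \<le> \<rho>" using lip by (rule lipschitz_on_nonneg)
  define h where "h t = t * (gradf x \<bullet> d) + t\<^sup>2 * (\<rho> / 2) * (norm d)\<^sup>2" for t
  have desc: "f (x + t *\<^sub>R d) \<le> f x + h t" for t
    using descent_lemma[OF grad lip, of x "t *\<^sub>R d"]
    by (simp add: h_def power_mult_distrib algebra_simps)
  fix t :: real assume t: "0 \<le> t" "t \<le> \<gamma>max \<or> \<gamma> < \<gamma>max"
  have "f (x + \<gamma> *\<^sub>R d) \<le> f x + h t"
    using rule
  proof
    assume "exact_line_search f x d \<gamma>max \<gamma>"
    then have min: "f (x + \<gamma> *\<^sub>R d) \<le> f (x + r *\<^sub>R d)" if "0 \<le> r" "r \<le> \<gamma>max" for r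
      using that by (auto simp: exact_line_search_def is_arg_min_def not_less)
    have "f (x + \<gamma> *\<^sub>R d) \<le> f (x + t *\<^sub>R d)"
    proof (cases "t \<le> \<gamma>max")
      case True then show ?thesis using min t by simp
    next
      case False
      then have lt: "\<gamma> < \<gamma>max" "\<gamma>max < t" using t by auto
      \<comment> \<open>This weight writes the point at \<open>\<gamma>max\<close> as a convex
        combination of the points at \<open>\<gamma>\<close> and \<open>t\<close>. As
        \<open>\<gamma>\<close> is at least as good as \<open>\<gamma>max\<close>, convexity makes
        it at least as good as \<open>t\<close>.\<close>
      define w where "w = (\<gamma>max - \<gamma>) / (t - \<gamma>)"
      have w: "0 < w" "w \<le> 1" and wt: "w * (t - \<gamma>) = \<gamma>max - \<gamma>"
        using lt by (auto simp: w_def)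
      have "x + \<gamma>max *\<^sub>R d = (1 - w) *\<^sub>R (x + \<gamma> *\<^sub>R d) + w *\<^sub>R (x + t *\<^sub>R d)"
      proof -
        have "x + \<gamma>max *\<^sub>R d = (x + \<gamma> *\<^sub>R d) + (w * (t - \<gamma>)) *\<^sub>R d"
          unfolding wt by (simp add: scaleR_diff_left)
        moreover have "x + t *\<^sub>R d = (x + \<gamma> *\<^sub>R d) + (t - \<gamma>) *\<^sub>R d"
          by (simp add: scaleR_diff_left)
        moreover have "(1 - w) *\<^sub>R z + w *\<^sub>R (z + (t - \<gamma>) *\<^sub>R d) = z + (w * (t - \<gamma>)) *\<^sub>R d" for z
          by (simp only: scaleR_diff_left[of 1] scaleR_add_right scaleR_scaleR) simp
        ultimately show ?thesis by metis
      qed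
      then have "f (x + \<gamma>max *\<^sub>R d) \<le> (1 - w) * f (x + \<gamma> *\<^sub>R d) + w * f (x + t *\<^sub>R d)"
        using convex_onD[OF conv, of w] w by simp
      then have "w * f (x + \<gamma> *\<^sub>R d) \<le> w * f (x + t *\<^sub>R d)"
        using min[of \<gamma>max] * by (simp add: algebra_simps)
      then show ?thesis using w by simp
    qed
    then show ?thesis using desc[of t] by simp
  next
    assume ad: "adaptive_stepsize gradf \<rho> x d \<gamma>max \<gamma>"
    then have min: "h \<gamma> \<le> h r" if "0 \<le> r" "r \<le> \<gamma>max" for r
      using that by (auto simp: adaptive_stepsize_def is_arg_min_def not_less h_def)
    have \<gamma>: "\<gamma> = min (- (gradf x \<bullet> d) / (\<rho> * (norm d)\<^sup>2)) \<gamma>max"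
      using ad by (simp add: adaptive_stepsize_def)
    have "h \<gamma> \<le> h t"
    proof (cases "t \<le> \<gamma>max")
      case True then show ?thesis using min t by simp
    next
      case False
      then have lt: "\<gamma> < \<gamma>max" using t by auto
      then have g: "\<gamma> = - (gradf x \<bullet> d) / (\<rho> * (norm d)\<^sup>2)" using \<gamma> by (auto simp: min_def split: if_splits)
      show ?thesis
      proof (cases "\<rho> * (norm d)\<^sup>2 = 0")
        case True
        \<comment> \<open>Division by zero makes the quotient 0. Minimality of 0 against
          \<open>\<gamma>max\<close> then forces a nonnegative slope, so the model, now linear, does
          not decrease.\<close>
        have "\<gamma> = 0" using g True by simp
        then have "0 \<le> \<gamma>max * (gradf x \<bullet> d)"
          using min[of \<gamma>max] * True by (auto simp: h_def)
        then have "0 \<le> gradf x \<bullet> d" using lt \<open>\<gamma> = 0\<close> by (simp add: zero_le_mult_iff)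
        then show ?thesis using \<open>\<gamma> = 0\<close> t True rho by (simp add: h_def)
      next
        case False
        then have s: "gradf x \<bullet> d = - \<gamma> * (\<rho> * (norm d)\<^sup>2)" using g by (simp add: field_simps)
        have "h t - h \<gamma> = (t - \<gamma>)\<^sup>2 * (\<rho> * (norm d)\<^sup>2) / 2"
          unfolding h_def s by (simp add: power2_eq_square algebra_simps)
        moreover have "0 \<le> (t - \<gamma>)\<^sup>2 * (\<rho> * (norm d)\<^sup>2) / 2" using rho by simp
        ultimately show ?thesis by simp
      qed
    qed
    then show ?thesis using desc[of \<gamma>] by simp
  qed
  then show "f (x + \<gamma> *\<^sub>R d) \<le> f x + t * (gradf x \<bullet> d) + t\<^sup>2 * (\<rho> / 2) * (norm d)\<^sup>2"
    by (simp add: h_def)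
qed

section \<open>Polyhedral geometry: the vertex-facet distance bounds the pairwise gap\<close>

text \<open>Process the elements of \<open>W\<close> one by one, giving each the largest weight up
  to \<open>\<mu> v\<close> that keeps every budget \<open>s i\<close>. An element that receives
  less than \<open>\<mu> v\<close> is blocked by an exhausted budget that it would consume.\<close>

lemma greedy_ratio_test:
  fixes s :: "'i::finite \<Rightarrow> real" and g :: "'v \<Rightarrow> 'i \<Rightarrow> real"
  assumes "finite W" and "\<And>i. 0 \<le> s i" and "\<And>v i. v \<in> W \<Longrightarrow> 0 \<le> g v i"
    and "\<And>v. v \<in> W \<Longrightarrow> 0 \<le> \<mu> v"
  shows "\<exists>\<delta>. (\<forall>v\<in>W. 0 \<le> \<delta> v \<and> \<delta> v \<le> \<mu> v) \<and> (\<forall>i. (\<Sum>v\<in>W. \<delta> v * g v i) \<le> s i) \<and>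
    (\<forall>v\<in>W. \<delta> v = \<mu> v \<or> (\<exists>i. 0 < g v i \<and> (\<Sum>v\<in>W. \<delta> v * g v i) = s i))"
  using assms
proof (induction W)
  case empty then show ?case by auto
next
  case (insert w W)
  have "\<exists>\<delta>. (\<forall>v\<in>W. 0 \<le> \<delta> v \<and> \<delta> v \<le> \<mu> v) \<and> (\<forall>i. (\<Sum>v\<in>W. \<delta> v * g v i) \<le> s i) \<and>
      (\<forall>v\<in>W. \<delta> v = \<mu> v \<or> (\<exists>i. 0 < g v i \<and> (\<Sum>v\<in>W. \<delta> v * g v i) = s i))"
    by (rule insert.IH) (use insert.prems in auto)
  then obtain \<delta> where \<delta>: "\<And>v. v \<in> W \<Longrightarrow> 0 \<le> \<delta> v \<and> \<delta> v \<le> \<mu> v"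
    "\<And>i. (\<Sum>v\<in>W. \<delta> v * g v i) \<le> s i"
    "\<And>v. v \<in> W \<Longrightarrow> \<delta> v = \<mu> v \<or> (\<exists>i. 0 < g v i \<and> (\<Sum>v\<in>W. \<delta> v * g v i) = s i)"
    by blast
  define r where "r i = s i - (\<Sum>v\<in>W. \<delta> v * g v i)" for i
  \<comment> \<open>The minimum ratio of the simplex method, capped by the available weight; the cap
    also keeps the set nonempty.\<close>
  define e where "e = Min (insert (\<mu> w) ((\<lambda>i. r i / g w i) ` {i. 0 < g w i}))"
  define \<delta>' where "\<delta>' = \<delta>(w := e)"
  have sum': "(\<Sum>v\<in>insert w W. \<delta>' v * g v i) = e * g w i + (\<Sum>v\<in>W. \<delta> v * g v i)" for i
  proof -
    have "(\<Sum>v\<in>W. \<delta>' v * g v i) = (\<Sum>v\<in>W. \<delta> v * g v i)"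
      using insert.hyps by (intro sum.cong) (auto simp: \<delta>'_def)
    then show ?thesis using insert.hyps by (simp add: \<delta>'_def)
  qed
  have r0: "0 \<le> r i" for i using \<delta>(2) by (simp add: r_def)
  have gw: "0 \<le> g w i" for i using insert.prems by simp
  have e0: "0 \<le> e" unfolding e_def using insert.prems r0 by (auto simp: Min_ge_iff)
  have e\<mu>: "e \<le> \<mu> w" unfolding e_def by (rule Min_le) auto
  have er: "e * g w i \<le> r i" for i
  proof (cases "0 < g w i")
    case True
    then have "e \<le> r i / g w i" unfolding e_def by (intro Min_le) auto
    then show ?thesis using True by (simp add: field_simps)
  next
    case False then have "g w i = 0" using gw[of i] by simp
    then show ?thesis using r0 by simp
  qed
  have "e \<in> insert (\<mu> w) ((\<lambda>i. r i / g w i) ` {i. 0 < g w i})"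
    unfolding e_def by (rule Min_in) auto
  then have ew: "e = \<mu> w \<or> (\<exists>i. 0 < g w i \<and> e * g w i = r i)" by auto
  show ?case
  proof (intro exI[of _ \<delta>'] conjI ballI allI)
    fix v assume "v \<in> insert w W"
    then show "0 \<le> \<delta>' v" "\<delta>' v \<le> \<mu> v" using \<delta>(1) e0 e\<mu> by (auto simp: \<delta>'_def)
    show "\<delta>' v = \<mu> v \<or> (\<exists>i. 0 < g v i \<and> (\<Sum>v\<in>insert w W. \<delta>' v * g v i) = s i)"
    proof (cases "v = w")
      case True
      then show ?thesis using ew unfolding sum' by (auto simp: \<delta>'_def r_def)
    next
      case False
      then have v: "v \<in> W" using \<open>v \<in> insert w W\<close> by simp
      from \<delta>(3)[OF v] show ?thesis
      proof
        assume "\<exists>i. 0 < g v i \<and> (\<Sum>v\<in>W. \<delta> v * g v i) = s i"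
        then obtain i where i: "0 < g v i" "(\<Sum>v\<in>W. \<delta> v * g v i) = s i" by blast
        \<comment> \<open>A budget that is already exhausted leaves no room for a positive
          consumption by \<open>w\<close>, so it stays tight after the insertion.\<close>
        have "0 \<le> e * g w i" using e0 gw by simp
        then have "e * g w i = 0" using er[of i] i(2) by (simp add: r_def)
        then show ?thesis using i unfolding sum' by auto
      qed (simp add: False \<delta>'_def)
    qed
  next
    fix i show "(\<Sum>v\<in>insert w W. \<delta>' v * g v i) \<le> s i"
      unfolding sum' using er[of i] by (simp add: r_def)
  qed
qed

lemma mem_polyhedron_of_iff: "x \<in> polyhedron_of A a \<longleftrightarrow> (\<forall>i. row i A \<bullet> x \<le> a $ i)"
  by (simp add: polyhedron_of_def less_eq_vec_def matrix_vector_mul_component row_def vec_lambda_eta)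

lemma polyhedron_polyhedron_of: "polyhedron (polyhedron_of A a)"
proof -
  have "polyhedron_of A a = \<Inter> ((\<lambda>i. {x. row i A \<bullet> x \<le> a $ i}) ` UNIV)"
    by (auto simp: mem_polyhedron_of_iff)
  then show ?thesis by (auto intro!: polyhedron_Inter polyhedron_halfspace_le)
qed

lemma finite_vertices_polyhedron_of: "finite (vertices (polyhedron_of A a))"
  unfolding vertices_def by (rule finite_polyhedron_extreme_points[OF polyhedron_polyhedron_of])

lemma vertices_subset: "vertices X \<subseteq> X"
  by (auto simp: vertices_def extreme_point_of_def)

text \<open>One vertex with slack in one row makes the sets under \<open>Min\<close> and
  \<open>Max\<close> nonempty; they are finite since there are finitely many vertices and
  rows.\<close>

lemma vertex_facet_bounds:
  assumes v: "v \<in> vertices (polyhedron_of A a)" and i: "row i A \<bullet> v < a $ i"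
  shows "0 < vertex_facet_zeta A a" "vertex_facet_zeta A a \<le> a $ i - row i A \<bullet> v"
    and "norm (row i A) \<le> vertex_facet_phi A a"
proof -
  define V where "V = vertices (polyhedron_of A a)"
  define S where "S = {a $ i - row i A \<bullet> v | v i. v \<in> V \<and> a $ i > row i A \<bullet> v}"
  have "S \<subseteq> (\<lambda>(v, i). a $ i - row i A \<bullet> v) ` (V \<times> UNIV)" by (auto simp: S_def)
  then have fin: "finite S"
    by (rule finite_subset) (simp add: V_def finite_vertices_polyhedron_of)
  have mem: "a $ i - row i A \<bullet> v \<in> S" using v i by (auto simp: S_def V_def)
  have zeta: "vertex_facet_zeta A a = Min S" by (simp add: vertex_facet_zeta_def S_def V_def)
  show "vertex_facet_zeta A a \<le> a $ i - row i A \<bullet> v"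
    unfolding zeta using fin mem by (rule Min_le)
  have "Min S \<in> S" using fin mem by (intro Min_in) auto
  then show "0 < vertex_facet_zeta A a" unfolding zeta by (auto simp: S_def)
  show "norm (row i A) \<le> vertex_facet_phi A a"
    unfolding vertex_facet_phi_def using v i by (intro Max_ge) force+
qed

lemma representation_of_support:
  assumes "finite V" "representation_of V (U, \<mu>) x"
  shows "finite U" "U \<subseteq> V" "sum \<mu> U = 1" "x = (\<Sum>v\<in>U. \<mu> v *\<^sub>R v)" "U \<noteq> {}"
    and "\<And>v. v \<in> U \<Longrightarrow> 0 < \<mu> v" "\<And>v. v \<in> V - U \<Longrightarrow> \<mu> v = 0"
proof -
  note rep = assms(2)[unfolded representation_of_def, simplified]
  show U: "U \<subseteq> V" "finite U" "\<And>v. v \<in> U \<Longrightarrow> 0 < \<mu> v"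
    using rep assms(1) by auto
  show z: "\<mu> v = 0" if "v \<in> V - U" for v using that rep by force
  have "sum \<mu> U = sum \<mu> V" using assms(1) U z by (intro sum.mono_neutral_left) auto
  then show s: "sum \<mu> U = 1" using rep by simp
  have "(\<Sum>v\<in>U. \<mu> v *\<^sub>R v) = (\<Sum>v\<in>V. \<mu> v *\<^sub>R v)"
    using assms(1) U z by (intro sum.mono_neutral_left) auto
  then show "x = (\<Sum>v\<in>U. \<mu> v *\<^sub>R v)" using rep by simp
  show "U \<noteq> {}" using s by auto
qed

lemma representation_of_mem:
  assumes "finite V" "representation_of V (U, \<mu>) x" "V \<subseteq> X" "convex X"
  shows "x \<in> X"
  unfolding representation_of_support(4)[OF assms(1,2)]
  using representation_of_support[OF assms(1,2)] assms(3,4)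
  by (intro convex_sum) (auto simp: less_imp_le)

text \<open>Move the representation of \<open>x\<close> towards \<open>y\<close> by transporting as little mass as possible: subtract
  vertices of \<open>U\<close> from \<open>y\<close> while the remainder \<open>w\<close> stays in the cone of multiples of \<open>X\<close>. Every
  vertex with mass left to transport is blocked by a constraint that is tight at \<open>w\<close> but not
  at that vertex.\<close>
lemma vertex_facet_gap:
  fixes A :: "real^'n^'m" and a :: "real^'m" and c x y :: "real^'n"
  defines "X \<equiv> polyhedron_of A a" and "\<Omega> \<equiv> vertex_facet_distance A a"
  assumes rep: "representation_of (vertices X) (U, \<mu>) x" and y: "y \<in> X"
    and p: "\<And>z. z \<in> X \<Longrightarrow> c \<bullet> p \<le> c \<bullet> z" and u: "\<And>v. v \<in> U \<Longrightarrow> c \<bullet> v \<le> c \<bullet> u"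
    and pos: "0 < c \<bullet> (x - y)"
  shows "0 \<le> \<Omega>" and "\<Omega> * (c \<bullet> (x - y)) \<le> real (card U) * norm (x - y) * (c \<bullet> (u - p))"
proof -
  have fV: "finite (vertices X)" unfolding X_def by (rule finite_vertices_polyhedron_of)
  note sup = representation_of_support[OF fV rep]
  have UX: "v \<in> X" if "v \<in> U" for v using that sup(2) vertices_subset by blast
  have cX: "convex X" unfolding X_def using polyhedron_polyhedron_of polyhedron_imp_convex by blast
  have xX: "x \<in> X" by (rule representation_of_mem[OF fV rep vertices_subset cX])
  have mem: "z \<in> X \<longleftrightarrow> (\<forall>i. row i A \<bullet> z \<le> a $ i)" for z
    unfolding X_def by (rule mem_polyhedron_of_iff)
  define g where "g v i = a $ i - row i A \<bullet> v" for v i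
  have "\<exists>\<delta>. (\<forall>v\<in>U. 0 \<le> \<delta> v \<and> \<delta> v \<le> \<mu> v) \<and> (\<forall>i. (\<Sum>v\<in>U. \<delta> v * g v i) \<le> g y i) \<and>
    (\<forall>v\<in>U. \<delta> v = \<mu> v \<or> (\<exists>i. 0 < g v i \<and> (\<Sum>v\<in>U. \<delta> v * g v i) = g y i))"
    by (rule greedy_ratio_test)
      (use sup(1,6) UX y in \<open>auto simp: g_def mem less_imp_le\<close>)
  then obtain \<delta> where d0: "\<And>v. v \<in> U \<Longrightarrow> 0 \<le> \<delta> v" and d1: "\<And>v. v \<in> U \<Longrightarrow> \<delta> v \<le> \<mu> v"
    and dg: "\<And>i. (\<Sum>v\<in>U. \<delta> v * g v i) \<le> g y i"
    and db: "\<And>v. v \<in> U \<Longrightarrow> \<delta> v = \<mu> v \<or> (\<exists>i. 0 < g v i \<and> (\<Sum>v\<in>U. \<delta> v * g v i) = g y i)"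
    by blast
  \<comment> \<open>\<open>l v\<close> is the mass of \<open>v\<close> that must be moved,
    \<open>\<Lambda>\<close> is the total moved mass, and \<open>w\<close> is what replaces it in
    \<open>y\<close>. The remaining ratio-test budget of row \<open>i\<close> equals the slack of
    \<open>w\<close> in the constraint scaled by \<open>\<Lambda>\<close>.\<close>
  define l where "l v = \<mu> v - \<delta> v" for v
  define \<Lambda> where "\<Lambda> = sum l U"
  define w where "w = y - (\<Sum>v\<in>U. \<delta> v *\<^sub>R v)"
  have l0: "0 \<le> l v" if "v \<in> U" for v using d1[OF that] by (simp add: l_def)
  have L0: "0 \<le> \<Lambda>" unfolding \<Lambda>_def using l0 by (intro sum_nonneg)
  have Ld: "sum \<delta> U = 1 - \<Lambda>" by (simp add: \<Lambda>_def l_def sum_subtractf sup(3))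
  have slack: "g y i - (\<Sum>v\<in>U. \<delta> v * g v i) = \<Lambda> * a $ i - row i A \<bullet> w" for i
  proof -
    have "(\<Sum>v\<in>U. \<delta> v * g v i) = sum \<delta> U * a $ i - row i A \<bullet> (\<Sum>v\<in>U. \<delta> v *\<^sub>R v)"
      by (simp add: g_def inner_sum_right sum_distrib_right right_diff_distrib sum_subtractf)
    then show ?thesis by (simp add: Ld w_def g_def inner_diff_right algebra_simps)
  qed
  have wL: "row i A \<bullet> w \<le> \<Lambda> * a $ i" for i using slack[of i] dg[of i] by simp
  have xy: "x - y = (\<Sum>v\<in>U. l v *\<^sub>R v) - w"
    by (simp add: l_def w_def scaleR_diff_left sum_subtractf sup(4)[symmetric])
  \<comment> \<open>Dividing \<open>w\<close> by \<open>\<Lambda>\<close> would require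
    \<open>\<Lambda>\<close> to be nonzero. Instead, a multiple \<open>t\<close> of \<open>w\<close>
    is added to \<open>x\<close> and the sum is normalized back into \<open>X\<close>; if the claim
    failed, the chosen \<open>t\<close> would be large enough to contradict the minimality of
    \<open>p\<close>.\<close>
  have cw: "\<Lambda> * (c \<bullet> p) \<le> c \<bullet> w"
  proof (rule ccontr)
    assume "\<not> ?thesis"
    then have e: "0 < \<Lambda> * (c \<bullet> p) - c \<bullet> w" (is "0 < ?e") by simp
    define t where "t = (c \<bullet> (x - p) + 1) / ?e"
    have "0 \<le> c \<bullet> (x - p)" using p[OF xX] by (simp add: inner_diff_right)
    then have t: "0 \<le> t" using e by (simp add: t_def)
    then have pos: "0 < 1 + t * \<Lambda>" using L0 by (simp add: add_pos_nonneg)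
    have "row i A \<bullet> (x + t *\<^sub>R w) \<le> (1 + t * \<Lambda>) * a $ i" for i
    proof -
      have "t * (row i A \<bullet> w) \<le> t * (\<Lambda> * a $ i)" using wL t by (intro mult_left_mono)
      moreover have "row i A \<bullet> x \<le> a $ i" using xX mem by blast
      ultimately show ?thesis by (simp add: inner_add_right algebra_simps)
    qed
    then have "(1 / (1 + t * \<Lambda>)) *\<^sub>R (x + t *\<^sub>R w) \<in> X"
      unfolding mem using pos by (simp add: divide_le_eq mult.commute)
    from p[OF this] have "(1 + t * \<Lambda>) * (c \<bullet> p) \<le> c \<bullet> (x + t *\<^sub>R w)"
      using pos by (simp add: le_divide_eq mult.commute)
    then have "t * ?e \<le> c \<bullet> (x - p)"
      by (simp add: inner_add_right inner_diff_right algebra_simps)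
    then show False using e by (simp add: t_def)
  qed
  have up: "c \<bullet> (x - y) \<le> \<Lambda> * (c \<bullet> (u - p))"
  proof -
    have "(\<Sum>v\<in>U. l v * (c \<bullet> v)) \<le> (\<Sum>v\<in>U. l v * (c \<bullet> u))"
      using l0 u by (intro sum_mono mult_left_mono)
    then have "c \<bullet> (\<Sum>v\<in>U. l v *\<^sub>R v) \<le> \<Lambda> * (c \<bullet> u)"
      by (simp add: inner_sum_right \<Lambda>_def sum_distrib_right)
    then show ?thesis using cw unfolding xy by (simp add: inner_diff_right right_diff_distrib)
  qed
  have LW: "0 < \<Lambda>" "0 < c \<bullet> (u - p)"
    using up pos L0 by (auto simp: zero_less_mult_iff dest: less_le_trans)
  \<comment> \<open>The vertex with most mass to move carries at least the average, which is the
    source of the factor \<open>card U\<close>. Its mass is positive, so the ratio test provides a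
    row tight at \<open>w\<close> but slack at \<open>v0\<close>.\<close>
  obtain v0 where v0: "v0 \<in> U" and max: "l v0 = Max (l ` U)"
    using obtains_MAX[OF sup(1,5), of l] by metis
  have Lv0: "\<Lambda> \<le> real (card U) * l v0"
    unfolding \<Lambda>_def max using sup(1) by (intro sum_bounded_above) simp
  then have lv0: "0 < l v0" using LW(1) by (metis less_le_trans mult_nonneg_nonpos not_less of_nat_0_le_iff)
  then obtain i where i: "0 < g v0 i" "(\<Sum>v\<in>U. \<delta> v * g v i) = g y i"
    using db[OF v0] by (auto simp: l_def)
  have tight: "row i A \<bullet> w = \<Lambda> * a $ i" using slack[of i] i(2) by simp
  have "l v0 * g v0 i \<le> (\<Sum>v\<in>U. l v * g v i)"
    using v0 sup(1) l0 UX by (intro member_le_sum) (auto simp: g_def mem)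
  also have "\<dots> = row i A \<bullet> (y - x)"
  proof -
    have "row i A \<bullet> (y - x) = - (row i A \<bullet> (x - y))" by (simp add: inner_diff_right)
    also have "\<dots> = \<Lambda> * a $ i - (\<Sum>v\<in>U. l v * (row i A \<bullet> v))"
      unfolding xy by (simp add: inner_diff_right inner_sum_right tight)
    also have "\<dots> = (\<Sum>v\<in>U. l v * g v i)"
      by (simp add: \<Lambda>_def g_def right_diff_distrib sum_subtractf sum_distrib_right)
    finally show ?thesis by simp
  qed
  also have "\<dots> \<le> norm (row i A) * norm (y - x)" by (rule norm_cauchy_schwarz)
  finally have key: "l v0 * g v0 i \<le> norm (row i A) * norm (x - y)" by (simp add: norm_minus_commute)
  let ?\<zeta> = "vertex_facet_zeta A a" and ?\<phi> = "vertex_facet_phi A a"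
  have "v0 \<in> vertices (polyhedron_of A a)" using v0 sup(2) by (auto simp: X_def)
  from vertex_facet_bounds[OF this] i(1)
  have z: "0 < ?\<zeta>" "?\<zeta> \<le> g v0 i" "norm (row i A) \<le> ?\<phi>" by (auto simp: g_def)
  then have ph: "0 \<le> ?\<phi>" using norm_ge_zero order_trans by blast
  then show O: "0 \<le> \<Omega>" using z by (simp add: \<Omega>_def vertex_facet_distance_def)
  have "l v0 * ?\<zeta> \<le> l v0 * g v0 i" using z lv0 by simp
  also note key
  also have "norm (row i A) * norm (x - y) \<le> ?\<phi> * norm (x - y)" using z by (intro mult_right_mono) auto
  \<comment> \<open>If \<open>?\<phi>\<close> is 0, division by zero makes \<open>\<Omega>\<close>
    zero and the bound is trivial.\<close>
  finally have Ol: "\<Omega> * l v0 \<le> norm (x - y)"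
    using ph by (cases "?\<phi> = 0") (auto simp: \<Omega>_def vertex_facet_distance_def divide_le_eq mult.commute)
  have "\<Omega> * (c \<bullet> (x - y)) \<le> \<Omega> * (\<Lambda> * (c \<bullet> (u - p)))" using up O by (rule mult_left_mono)
  also have "\<dots> \<le> \<Omega> * ((real (card U) * l v0) * (c \<bullet> (u - p)))"
    using Lv0 O LW by (intro mult_left_mono mult_right_mono) auto
  also have "\<dots> = real (card U) * (\<Omega> * l v0) * (c \<bullet> (u - p))" by simp
  also have "\<dots> \<le> real (card U) * norm (x - y) * (c \<bullet> (u - p))"
    using Ol LW by (intro mult_left_mono mult_right_mono) auto
  finally show "\<Omega> * (c \<bullet> (x - y)) \<le> real (card U) * norm (x - y) * (c \<bullet> (u - p))" .
qed

section \<open>Forward and away updates of the convex representation\<close>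

text \<open>Common form of both updates: a forward step has \<open>s = \<gamma>\<close> and
  \<open>w = p\<close>, an away step \<open>s = - \<gamma>\<close> and \<open>w = u\<close>. Since
  \<open>s\<close> may be negative, nonnegativity of the new weights is an assumption.\<close>

lemma representation_of_affine_update:
  assumes fin: "finite V" and rep: "representation_of V (U, \<mu>) x" and w: "w \<in> V"
    and nonneg: "\<And>v. v \<in> V \<Longrightarrow> 0 \<le> \<mu>' v"
    and eq: "\<And>v. v \<in> V \<Longrightarrow> \<mu>' v = (1 - s) * \<mu> v + (if v = w then s else 0)"
  shows "representation_of V ({v\<in>V. \<mu>' v > 0}, \<mu>') (x + s *\<^sub>R (w - x))"
proof -
  have "sum \<mu>' V = (\<Sum>v\<in>V. (1 - s) * \<mu> v + (if v = w then s else 0))"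
    using eq by (rule sum.cong[OF refl])
  also have "\<dots> = (1 - s) * sum \<mu> V + s"
    using fin w by (simp add: sum.distrib sum_distrib_left)
  finally have 1: "sum \<mu>' V = 1" using rep by (simp add: representation_of_def)
  have "(\<Sum>v\<in>V. \<mu>' v *\<^sub>R v) = (\<Sum>v\<in>V. (1 - s) *\<^sub>R \<mu> v *\<^sub>R v + (if v = w then s *\<^sub>R v else 0))"
    using eq by (intro sum.cong) (auto simp: scaleR_add_left)
  also have "\<dots> = (1 - s) *\<^sub>R (\<Sum>v\<in>V. \<mu> v *\<^sub>R v) + s *\<^sub>R w"
    using fin w by (simp add: sum.distrib scaleR_sum_right)
  also have "\<dots> = x + s *\<^sub>R (w - x)"
    using rep by (simp add: representation_of_def algebra_simps)
  finally show ?thesis using 1 nonneg by (simp add: representation_of_def)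
qed

text \<open>Positivity of \<open>\<gamma>\<close> matters: a zero step would put \<open>p\<close>
  into the support set even if its weight is 0.\<close>

lemma representation_of_forward_update:
  assumes fin: "finite V" and rep: "representation_of V (U, \<mu>) x" and p: "p \<in> V"
    and \<gamma>: "0 < \<gamma>" "\<gamma> \<le> 1"
  shows "representation_of V (forward_update p \<gamma> (U, \<mu>)) (x + \<gamma> *\<^sub>R (p - x))"
    and "fst (forward_update p \<gamma> (U, \<mu>)) \<subseteq> insert p U"
proof -
  note sup = representation_of_support[OF fin rep]
  define \<mu>' where "\<mu>' = (\<lambda>v. if v = p then \<mu> p * (1 - \<gamma>) + \<gamma>
    else if v \<in> U then \<mu> v * (1 - \<gamma>) else \<mu> v)"
  have upd: "forward_update p \<gamma> (U, \<mu>) = (if \<mu>' p = 1 then {p} else U \<union> {p}, \<mu>')"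
    by (simp add: forward_update_def \<mu>'_def Let_def)
  show "fst (forward_update p \<gamma> (U, \<mu>)) \<subseteq> insert p U" unfolding upd by auto
  have mu0: "0 \<le> \<mu> v" if "v \<in> V" for v using that rep by (simp add: representation_of_def)
  have nn: "0 \<le> \<mu>' v" if "v \<in> V" for v using mu0 that p \<gamma> by (simp add: \<mu>'_def add_nonneg_nonneg)
  have eq: "\<mu>' v = (1 - \<gamma>) * \<mu> v + (if v = p then \<gamma> else 0)" if "v \<in> V" for v
    using sup(7)[of v] that by (auto simp: \<mu>'_def)
  note R = representation_of_affine_update[OF fin rep p nn eq]
  have p0: "0 < \<mu>' p" using mu0[OF p] \<gamma> by (simp add: \<mu>'_def add_nonneg_pos)
  have "(if \<mu>' p = 1 then {p} else U \<union> {p}) = {v\<in>V. \<mu>' v > 0}"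
  proof (cases "\<mu>' p = 1")
    case True
    have "sum \<mu>' V = 1" using R by (simp add: representation_of_def)
    then have "sum \<mu>' (V - {p}) = 0" using fin p True by (simp add: sum_diff1)
    then have "\<forall>v\<in>V - {p}. \<mu>' v = 0" using fin nn by (subst (asm) sum_nonneg_eq_0_iff) auto
    then have "{v\<in>V. \<mu>' v > 0} \<subseteq> {p}" by (metis (mono_tags, lifting) DiffI less_irrefl mem_Collect_eq subsetI)
    moreover have "{p} \<subseteq> {v\<in>V. \<mu>' v > 0}" using True p by simp
    ultimately show ?thesis using True by simp
  next
    case False
    then have "\<gamma> \<noteq> 1" by (auto simp: \<mu>'_def)
    \<comment> \<open>A full step would give \<open>p\<close> weight 1, which this case excludes;
      with \<open>\<gamma>\<close> below 1 every old vertex keeps a positive weight.\<close>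
    then have "\<gamma> < 1" using \<gamma> by simp
    have "0 < \<mu>' v \<longleftrightarrow> v = p \<or> v \<in> U" if v: "v \<in> V" for v
    proof -
      consider "v = p" | "v \<noteq> p" "v \<in> U" | "v \<noteq> p" "v \<notin> U" by blast
      then show ?thesis
      proof cases
        case 2 then show ?thesis using sup(6)[of v] \<open>\<gamma> < 1\<close> by (simp add: \<mu>'_def)
      next
        case 3 then show ?thesis using sup(7)[of v] v by (simp add: \<mu>'_def)
      qed (simp add: p0)
    qed
    then show ?thesis using False sup(2) p by auto
  qed
  then show "representation_of V (forward_update p \<gamma> (U, \<mu>)) (x + \<gamma> *\<^sub>R (p - x))"
    using R by (simp add: upd)
qed

text \<open>The upper bound on \<open>\<gamma>\<close> says exactly that the new weight of
  \<open>u\<close> is nonnegative, and equality says that it vanishes, which is a drop step.\<close>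

lemma representation_of_away_update:
  assumes fin: "finite V" and rep: "representation_of V (U, \<mu>) x" and u: "u \<in> U"
    and lt: "\<mu> u < 1" and \<gamma>: "0 \<le> \<gamma>" "\<gamma> \<le> \<mu> u / (1 - \<mu> u)"
  shows "representation_of V (away_update u \<gamma> (U, \<mu>)) (x + \<gamma> *\<^sub>R (x - u))"
    and "fst (away_update u \<gamma> (U, \<mu>)) \<subseteq> U"
    and "\<gamma> = \<mu> u / (1 - \<mu> u) \<Longrightarrow> fst (away_update u \<gamma> (U, \<mu>)) = U - {u}"
proof -
  note sup = representation_of_support[OF fin rep]
  define \<mu>' where "\<mu>' = (\<lambda>v. if v = u then \<mu> u * (1 + \<gamma>) - \<gamma>
    else if v \<in> U then \<mu> v * (1 + \<gamma>) else \<mu> v)"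
  have upd: "away_update u \<gamma> (U, \<mu>) = (if \<mu>' u = 0 then U - {u} else U, \<mu>')"
    by (simp add: away_update_def \<mu>'_def Let_def)
  show "fst (away_update u \<gamma> (U, \<mu>)) \<subseteq> U" unfolding upd by auto
  show "fst (away_update u \<gamma> (U, \<mu>)) = U - {u}" if "\<gamma> = \<mu> u / (1 - \<mu> u)"
    using that lt unfolding upd by (simp add: \<mu>'_def field_simps)
  have "\<gamma> * (1 - \<mu> u) \<le> \<mu> u" using \<gamma> lt by (simp add: le_divide_eq)
  then have u0: "0 \<le> \<mu>' u" by (simp add: \<mu>'_def algebra_simps)
  have mu0: "0 \<le> \<mu> v" if "v \<in> V" for v using that rep by (simp add: representation_of_def)
  have nn: "0 \<le> \<mu>' v" if "v \<in> V" for v using mu0[OF that] \<gamma> u0 by (auto simp: \<mu>'_def)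
  have eq: "\<mu>' v = (1 - - \<gamma>) * \<mu> v + (if v = u then - \<gamma> else 0)" if "v \<in> V" for v
    using sup(7)[of v] that by (auto simp: \<mu>'_def)
  have "u \<in> V" using u sup(2) by auto
  note R = representation_of_affine_update[OF fin rep this nn eq]
  have "0 < \<mu>' v \<longleftrightarrow> v \<in> U" if "v \<in> V" "v \<noteq> u" for v
    using sup(6)[of v] sup(7)[of v] that \<gamma> by (auto simp: \<mu>'_def)
  then have "(if \<mu>' u = 0 then U - {u} else U) = {v\<in>V. \<mu>' v > 0}"
    using u0 u sup(2) by (cases "\<mu>' u = 0") (auto simp: less_le)
  moreover have "x + \<gamma> *\<^sub>R (x - u) = x + (- \<gamma>) *\<^sub>R (u - x)" by (simp add: algebra_simps)
  ultimately show "representation_of V (away_update u \<gamma> (U, \<mu>)) (x + \<gamma> *\<^sub>R (x - u))"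
    using R by (simp add: upd)
qed

section \<open>Hoffman error bound for the composite objective\<close>

lemma append_row_component:
  "(append_row E b *v x) $ i = (case i of Some j \<Rightarrow> (E *v x) $ j | None \<Rightarrow> b \<bullet> x)"
  by (simp add: matrix_vector_mul_component append_row_def row_def vec_lambda_eta split: option.split)

lemma append_row_eq_iff:
  "append_row E b *v x = append_row E b *v y \<longleftrightarrow> E *v x = E *v y \<and> b \<bullet> x = b \<bullet> y"
  by (auto simp: vec_eq_iff append_row_component split_option_all)

lemma norm_append_row_diff:
  "(norm (append_row E b *v x - append_row E b *v y))\<^sup>2
    = (norm (E *v x - E *v y))\<^sup>2 + (b \<bullet> (x - y))\<^sup>2"
proof -
  have "(norm (append_row E b *v x - append_row E b *v y))\<^sup>2
      = (\<Sum>i\<in>UNIV. ((append_row E b *v x) $ i - (append_row E b *v y) $ i)\<^sup>2)"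
    unfolding power2_norm_eq_inner inner_vec_def by (simp add: power2_eq_square)
  also have "\<dots> = (b \<bullet> x - b \<bullet> y)\<^sup>2 + (\<Sum>j\<in>UNIV. ((E *v x) $ j - (E *v y) $ j)\<^sup>2)"
    by (simp add: UNIV_option_conv sum.reindex append_row_component)
  also have "\<dots> = (b \<bullet> (x - y))\<^sup>2 + (norm (E *v x - E *v y))\<^sup>2"
    unfolding power2_norm_eq_inner inner_vec_def[of "E *v x - E *v y"]
    by (simp add: power2_eq_square inner_diff_right)
  finally show ?thesis by simp
qed

text \<open>Both sides are the derivative at 0 of the objective along the same line, so uniqueness
  of derivatives identifies them without the transpose of \<open>E\<close>.\<close>

lemma composite_gradient:
  fixes E :: "real^'n^'q"
  assumes "GDERIV g (E *v x) :> gg" and "GDERIV (\<lambda>y. g (E *v y) + b \<bullet> y) x :> gf"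
  shows "gf \<bullet> d = gg \<bullet> (E *v d) + b \<bullet> d"
proof (rule DERIV_unique)
  show "DERIV (\<lambda>t. g (E *v (x + t *\<^sub>R d)) + b \<bullet> (x + t *\<^sub>R d)) 0 :> gf \<bullet> d"
    using assms(2) by (intro GDERIV_line[of "\<lambda>y. g (E *v y) + b \<bullet> y"]) simp
  have "DERIV (\<lambda>t. g (E *v x + t *\<^sub>R (E *v d))) 0 :> gg \<bullet> (E *v d)"
    using assms(1) by (intro GDERIV_line) simp
  moreover have "DERIV (\<lambda>t. b \<bullet> x + t * (b \<bullet> d)) 0 :> b \<bullet> d"
    by (auto intro!: derivative_eq_intros)
  ultimately have "DERIV (\<lambda>t. g (E *v x + t *\<^sub>R (E *v d)) + (b \<bullet> x + t * (b \<bullet> d))) 0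
      :> gg \<bullet> (E *v d) + b \<bullet> d"
    by (rule DERIV_add)
  then show "DERIV (\<lambda>t. g (E *v (x + t *\<^sub>R d)) + b \<bullet> (x + t *\<^sub>R d)) 0 :> gg \<bullet> (E *v d) + b \<bullet> d"
    by (simp add: matrix_vector_right_distrib matrix_vector_mult_scaleR inner_add_right)
qed

lemma composite_strong_convexity:
  fixes E :: "real^'n^'q"
  assumes sc: "strongly_convex \<sigma> g" and f: "f = (\<lambda>y. g (E *v y) + b \<bullet> y)" and t: "0 \<le> t" "t \<le> 1"
  shows "f (x + t *\<^sub>R (y - x))
    \<le> f x + t * (f y - f x) - t * (1 - t) * (\<sigma> / 2 * (norm (E *v y - E *v x))\<^sup>2)"
proof -
  have "E *v (x + t *\<^sub>R (y - x)) = t *\<^sub>R (E *v y) + (1 - t) *\<^sub>R (E *v x)"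
    by (simp add: matrix_vector_right_distrib matrix_vector_mult_scaleR matrix_vector_mult_diff_distrib
        scaleR_diff_right scaleR_diff_left)
  moreover have "g (t *\<^sub>R (E *v y) + (1 - t) *\<^sub>R (E *v x)) \<le> t * g (E *v y) + (1 - t) * g (E *v x)
      - \<sigma> / 2 * t * (1 - t) * (norm (E *v y - E *v x))\<^sup>2"
    using sc t by (simp add: strongly_convex_def)
  ultimately show ?thesis
    by (simp add: f inner_add_right inner_diff_right algebra_simps)
qed

lemma first_order_optimality:
  fixes f :: "'a::real_inner \<Rightarrow> real"
  assumes grad: "GDERIV f z :> g" and X: "convex X" "z \<in> X" "y \<in> X"
    and opt: "\<And>w. w \<in> X \<Longrightarrow> f z \<le> f w"
  shows "0 \<le> g \<bullet> (y - z)"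
proof -
  have "DERIV (\<lambda>t. f (z + t *\<^sub>R (y - z))) 0 :> g \<bullet> (y - z)"
    using grad by (intro GDERIV_line) simp
  then have "((\<lambda>t. (f (z + t *\<^sub>R (y - z)) - f z) / t) \<longlongrightarrow> g \<bullet> (y - z)) (at_right 0)"
    by (simp add: DERIV_def filterlim_at_split)
  moreover have "\<forall>\<^sub>F t in at_right 0. 0 \<le> (f (z + t *\<^sub>R (y - z)) - f z) / t"
  proof (rule eventually_at_rightI[of 0 1])
    fix t :: real assume t: "t \<in> {0<..<1}"
    have "(1 - t) *\<^sub>R z + t *\<^sub>R y \<in> X"
      using t X by (intro convexD) auto
    then have "f z \<le> f (z + t *\<^sub>R (y - z))" using opt by (simp add: algebra_simps)
    then show "0 \<le> (f (z + t *\<^sub>R (y - z)) - f z) / t" using t by simp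
  qed simp
  ultimately show ?thesis
    by (rule tendsto_lowerbound) (rule trivial_limit_at_right_real)
qed

text \<open>The objective depends only on \<open>E *v z\<close> and \<open>b \<bullet> z\<close>, so
  every point of \<open>X\<close> sharing these values with \<open>xs\<close> is optimal, and
  Hoffman's inequality bounds the distance to such points. What remains is to bound the residual,
  whose square is that of the \<open>E\<close> part plus that of the \<open>b\<close> part, by the
  optimality gap.\<close>

lemma hoffman_error_bound:
  fixes A :: "real^'n^'m" and a :: "real^'m" and E :: "real^'n^'q" and xs x :: "real^'n"
  defines "X \<equiv> polyhedron_of A a"
  assumes hoff: "hoffman_constant A a (append_row E b) \<theta>"
    and g: "\<And>z. GDERIV g z :> gradg z" and sc: "strongly_convex \<sigma> g"
    and f: "f = (\<lambda>y. g (E *v y) + b \<bullet> y)" and gradf: "\<And>z. GDERIV f z :> gradf z"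
    and xs: "xs \<in> X" and opt: "\<And>w. w \<in> X \<Longrightarrow> f xs \<le> f w" and x: "x \<in> X"
    and D: "norm (x - xs) \<le> D" and DE: "norm (E *v x - E *v xs) \<le> DE"
    and G: "norm (gradg (E *v xs)) \<le> G"
  obtains y where "y \<in> X" "f y = f xs"
    "(norm (x - y))\<^sup>2 \<le> \<theta>\<^sup>2 * (norm b * D + 3 * G * DE + 2 * (G\<^sup>2 + 1) / \<sigma>) * (f x - f xs)"
proof -
  have \<sigma>: "0 < \<sigma>" using sc by (simp add: strongly_convex_def)
  have pX: "polyhedron X" unfolding X_def by (rule polyhedron_polyhedron_of)
  let ?M = "append_row E b"
  define S where "S = {z. ?M *v z = ?M *v xs}"
  have "closed S"
    unfolding S_def by (intro closed_Collect_eq continuous_intros matrix_vector_mult_linear_continuous_on)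
  then have cl: "closed (X \<inter> S)" using pX polyhedron_imp_closed by blast
  have ne: "X \<inter> S \<noteq> {}" using xs by (auto simp: S_def)
  obtain y where y: "y \<in> X \<inter> S" "infdist x (X \<inter> S) = dist x y"
    using infdist_attains_inf[OF cl ne] by blast
  have "infdist x (X \<inter> S) \<le> \<theta> * norm (?M *v x - ?M *v xs)"
    using hoff ne x unfolding hoffman_constant_def Let_def X_def S_def by blast
  then have dist: "norm (x - y) \<le> \<theta> * norm (?M *v x - ?M *v xs)" by (simp add: y dist_norm)
  define P where "P = gradf xs \<bullet> (x - xs)"
  define Q where "Q = gradg (E *v xs) \<bullet> (E *v x - E *v xs)"
  define h where "h = f x - f xs"
  define e where "e = norm (E *v x - E *v xs)"
  \<comment> \<open>The slope along \<open>b\<close> is the slope \<open>P\<close> of the objective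
    minus the slope \<open>Q\<close> of its \<open>g\<close> part; optimality and strong convexity
    control \<open>P\<close>, and the gradient bound \<open>G\<close> controls
    \<open>Q\<close>.\<close>
  have b: "b \<bullet> (x - xs) = P - Q"
    using composite_gradient[OF g, where E = E and x = xs and b = b and d = "x - xs"] gradf[of xs]
    by (simp add: f P_def Q_def matrix_vector_mult_diff_distrib)
  have P0: "0 \<le> P"
    unfolding P_def using pX polyhedron_imp_convex
    by (intro first_order_optimality[OF gradf _ xs x opt]) blast
  have first: "P + \<sigma> / 2 * e\<^sup>2 \<le> h"
    unfolding P_def e_def h_def
    by (rule strong_convexity_first_order[OF gradf composite_strong_convexity[OF sc f]])
  then have e2: "e\<^sup>2 \<le> 2 / \<sigma> * h" using P0 \<sigma> by (simp add: field_simps)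
  have "0 \<le> \<sigma> / 2 * e\<^sup>2" using \<sigma> by simp
  then have Ph: "P \<le> h" and h0: "0 \<le> h" using first P0 by linarith+
  have G0: "0 \<le> G" using G norm_ge_zero order_trans by blast
  have DE0: "0 \<le> DE" using DE norm_ge_zero order_trans by blast
  have "\<bar>Q\<bar> \<le> norm (gradg (E *v xs)) * e" unfolding Q_def e_def by (rule Cauchy_Schwarz_ineq2)
  also have "\<dots> \<le> G * e" using G by (intro mult_right_mono) (auto simp: e_def)
  finally have Qe: "\<bar>Q\<bar> \<le> G * e" .
  have "G * e \<le> G * DE" using DE G0 by (intro mult_left_mono) (auto simp: e_def)
  then have QD: "\<bar>Q\<bar> \<le> G * DE" using Qe by simp
  have "Q\<^sup>2 \<le> (G * e)\<^sup>2" using Qe by (metis abs_ge_zero power2_abs power_mono)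
  also have "\<dots> \<le> G\<^sup>2 * (2 / \<sigma> * h)" using e2 unfolding power_mult_distrib by (intro mult_left_mono) auto
  finally have Q2: "Q\<^sup>2 \<le> G\<^sup>2 * (2 / \<sigma> * h)" .
  have "b \<bullet> (x - xs) \<le> norm b * norm (x - xs)" by (rule norm_cauchy_schwarz)
  also have "\<dots> \<le> norm b * D" using D by (intro mult_left_mono) auto
  finally have bD: "P - Q \<le> norm b * D" by (simp add: b)
  have bD0: "0 \<le> norm b * D" using D norm_ge_zero order_trans by (metis mult_nonneg_nonneg)
  \<comment> \<open>In this splitting \<open>P - 2 * Q\<close> is bounded by constants while
    \<open>P\<close> is at most the gap \<open>h\<close>. The term \<open>Q\<^sup>2\<close> is of
    order \<open>h\<close> by strong convexity and yields the \<open>G\<^sup>2\<close> in the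
    constant; the 1 next to it comes from the \<open>E\<close> part of the residual.\<close>
  have "(P - Q)\<^sup>2 = P * (P - 2 * Q) + Q\<^sup>2" by (simp add: power2_eq_square algebra_simps)
  also have "P * (P - 2 * Q) \<le> P * (norm b * D + 3 * G * DE)"
    using P0 bD QD G0 DE0 by (intro mult_left_mono) auto
  also have "\<dots> \<le> h * (norm b * D + 3 * G * DE)"
    using Ph bD0 G0 DE0 by (intro mult_right_mono) auto
  finally have "(P - Q)\<^sup>2 \<le> h * (norm b * D + 3 * G * DE) + G\<^sup>2 * (2 / \<sigma> * h)" using Q2 by simp
  then have "(norm (?M *v x - ?M *v xs))\<^sup>2
      \<le> (norm b * D + 3 * G * DE + 2 * (G\<^sup>2 + 1) / \<sigma>) * h"
    using e2 unfolding norm_append_row_diff b e_def[symmetric]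
    by (simp add: algebra_simps add_divide_distrib)
  then have "\<theta>\<^sup>2 * (norm (?M *v x - ?M *v xs))\<^sup>2
      \<le> \<theta>\<^sup>2 * ((norm b * D + 3 * G * DE + 2 * (G\<^sup>2 + 1) / \<sigma>) * h)"
    by (intro mult_left_mono) auto
  moreover have "(norm (x - y))\<^sup>2 \<le> (\<theta> * norm (?M *v x - ?M *v xs))\<^sup>2"
    using dist by (intro power_mono) auto
  ultimately have "(norm (x - y))\<^sup>2 \<le> \<theta>\<^sup>2 * (norm b * D + 3 * G * DE + 2 * (G\<^sup>2 + 1) / \<sigma>) * h"
    by (simp add: power_mult_distrib)
  moreover have "f y = f xs" using y by (simp add: S_def append_row_eq_iff f)
  ultimately show thesis using that[of y] y by (simp add: h_def)
qed

section \<open>Progress of a single iteration\<close>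

text \<open>Comparison with stepsize 0. No valid representation is assumed, so this also covers
  iterations after an optimal point has been reached.\<close>

lemma ascg_step_nonincreasing:
  fixes f :: "'a::euclidean_space \<Rightarrow> real"
  assumes "\<And>x. GDERIV f x :> gradf x" "\<rho>-lipschitz_on UNIV gradf" "convex_on UNIV f"
    and step: "ascg_step f gradf \<rho> lmo R x U \<mu> x' U' \<mu>'"
  shows "f x' \<le> f x"
proof -
  obtain d \<gamma>max \<gamma> where
    rule: "exact_line_search f x d \<gamma>max \<gamma> \<or> adaptive_stepsize gradf \<rho> x d \<gamma>max \<gamma>"
    and x': "x' = x + \<gamma> *\<^sub>R d"
    using step unfolding ascg_step_def by blast
  note dec = step_rule_decrease[OF assms(1-3) rule]
  show ?thesis using dec(3)[of 0] dec(1,2) by (simp add: x')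
qed

text \<open>Minimizing the quadratic model along \<open>d\<close> gains the squared slope over
  \<open>2 * \<rho> * (norm d)\<^sup>2\<close>, and \<open>gap\<close> makes this at least
  \<open>\<alpha> * h\<close>. Only an away step cut off at \<open>\<gamma>max\<close> can miss this
  gain, and such a step drops a vertex. In the application \<open>h\<close> is the optimality
  gap.\<close>

lemma ascg_step_progress:
  fixes f :: "'a::euclidean_space \<Rightarrow> real"
  assumes grad: "\<And>x. GDERIV f x :> gradf x" and lip: "\<rho>-lipschitz_on UNIV gradf"
    and conv: "convex_on UNIV f" and X: "convex X" and fin: "finite (vertices X)"
    and diam: "\<And>y z. y \<in> X \<Longrightarrow> z \<in> X \<Longrightarrow> norm (y - z) \<le> D"
    and lmo: "vertex_linear_oracle X lmo" and R: "representation_reduction (vertices X) R N"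
    and rep: "representation_of (vertices X) (U, \<mu>) x"
    and step: "ascg_step f gradf \<rho> lmo R x U \<mu> x' U' \<mu>'"
    and h: "0 < h" "h \<le> gradf x \<bullet> (x - lmo (gradf x))" and \<alpha>: "0 \<le> \<alpha>" "\<alpha> \<le> 1 / 2"
    and gap: "\<And>u. u \<in> U \<Longrightarrow> (\<And>v. v \<in> U \<Longrightarrow> gradf x \<bullet> v \<le> gradf x \<bullet> u) \<Longrightarrow>
      8 * \<rho> * D\<^sup>2 * (\<alpha> * h) \<le> (gradf x \<bullet> (u - lmo (gradf x)))\<^sup>2"
  shows "representation_of (vertices X) (U', \<mu>') x'" "card U' \<le> N"
    and "f x' \<le> f x \<and> card U' < card U \<or> f x' \<le> f x - \<alpha> * h \<and> card U' \<le> Suc (card U)"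
proof -
  define V where "V = vertices X"
  define c where "c = gradf x"
  have fV: "finite V" using fin by (simp add: V_def)
  have repV: "representation_of V (U, \<mu>) x" using rep by (simp add: V_def)
  note sup = representation_of_support[OF fV repV]
  obtain p u fwd d \<gamma>max \<gamma> where p: "p = lmo c" and
    um: "is_arg_max (\<lambda>v. c \<bullet> v) (\<lambda>v. v \<in> U) u" and
    fwd: "fwd \<longleftrightarrow> c \<bullet> (p - x) \<le> c \<bullet> (x - u)" and
    d: "d = (if fwd then p - x else x - u)" and
    gm: "\<gamma>max = (if fwd then 1 else \<mu> u / (1 - \<mu> u))" and
    rule: "exact_line_search f x d \<gamma>max \<gamma> \<or> adaptive_stepsize gradf \<rho> x d \<gamma>max \<gamma>" and
    x': "x' = x + \<gamma> *\<^sub>R d" and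
    upd: "(U', \<mu>') = R (if fwd then forward_update p \<gamma> (U, \<mu>) else away_update u \<gamma> (U, \<mu>))"
    using step[unfolded ascg_step_def, folded c_def] by blast
  have umax: "c \<bullet> v \<le> c \<bullet> u" if "v \<in> U" for v
    using um that by (auto simp: is_arg_max_def not_less)
  have uU: "u \<in> U" using um by (simp add: is_arg_max_def)
  have pV: "p \<in> V" using lmo p by (simp add: vertex_linear_oracle_def V_def)
  have VX: "V \<subseteq> X" unfolding V_def by (rule vertices_subset)
  have xX: "x \<in> X" by (rule representation_of_mem[OF fV repV VX X])
  note dec = step_rule_decrease[OF grad lip conv rule, folded x' c_def]
  have rho: "0 \<le> \<rho>" using lip by (rule lipschitz_on_nonneg)
  define s where "s = c \<bullet> d"
  have "c \<bullet> x = (\<Sum>v\<in>U. \<mu> v * (c \<bullet> v))" by (subst sup(4)) (simp add: inner_sum_right)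
  also have "\<dots> \<le> (\<Sum>v\<in>U. \<mu> v * (c \<bullet> u))"
    using umax sup(6) by (intro sum_mono mult_left_mono) (auto simp: less_imp_le)
  finally have cxu: "c \<bullet> x \<le> c \<bullet> u" by (simp add: sum_distrib_right[symmetric] sup(3))
  have hp: "h \<le> c \<bullet> x - c \<bullet> p" using h by (simp add: c_def p inner_diff_right)
  \<comment> \<open>The test picks the smaller of the forward and away slopes. The forward slope is
    at most \<open>- h\<close>, and the two slopes add up to minus the pairwise gap.\<close>
  have sh: "s \<le> - h" and s2: "2 * s \<le> - (c \<bullet> (u - p))"
    using hp cxu fwd by (auto simp: s_def d inner_diff_right split: if_splits)
  have s0: "s < 0" using sh h by simp
  then have d0: "d \<noteq> 0" by (auto simp: s_def)
  have dD: "norm d \<le> D" using diam xX pV uU sup(2) VX by (auto simp: d)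
  have "(c \<bullet> (u - p))\<^sup>2 \<le> (2 * s)\<^sup>2"
  proof -
    have "0 \<le> c \<bullet> (u - p)" using cxu hp h by (simp add: inner_diff_right)
    then have "(c \<bullet> (u - p))\<^sup>2 \<le> (- (2 * s))\<^sup>2" using s2 by (intro power_mono) auto
    then show ?thesis by simp
  qed
  moreover have "8 * \<rho> * D\<^sup>2 * (\<alpha> * h) \<le> (c \<bullet> (u - p))\<^sup>2"
    using gap[OF uU] umax by (simp add: c_def p)
  ultimately have gap': "2 * \<rho> * D\<^sup>2 * (\<alpha> * h) \<le> s\<^sup>2" by (simp add: power_mult_distrib)
  have ah: "\<alpha> * h \<le> h / 2" using \<alpha> h by (simp add: mult_right_mono[of \<alpha> "1/2" h, simplified])
  have progress: "f x' \<le> f x - \<alpha> * h \<and> f x' < f x" if full: "\<gamma>max = 1 \<or> \<gamma> < \<gamma>max"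
  proof (cases "\<rho> = 0")
    case True
    \<comment> \<open>With \<open>\<rho> = 0\<close> the model is linear, and this stepsize
      decreases it by exactly \<open>h\<close>.\<close>
    have "h / (- s) \<le> 1" "0 \<le> h / (- s)" using s0 sh h by (auto simp: field_simps)
    then have "f x' \<le> f x + h / (- s) * s" using dec(3)[of "h / (- s)"] full True
      by (auto simp: s_def)
    then have "f x' \<le> f x - h" using s0 by simp
    then show ?thesis using ah h by linarith
  next
    case False
    define q where "q = \<rho> * (norm d)\<^sup>2"
    have q: "0 < q" using False rho d0 by (simp add: q_def)
    \<comment> \<open>The unconstrained minimizer of the quadratic model.\<close>
    define t where "t = - s / q"
    have t: "0 \<le> t" using s0 q by (simp add: t_def divide_nonpos_pos)
    show ?thesis
    proof (cases "t \<le> \<gamma>max \<or> \<gamma> < \<gamma>max")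
      case True
      have "f x' \<le> f x + t * s + t\<^sup>2 * q / 2"
        using dec(3)[OF t True] by (simp add: s_def q_def)
      also have "\<dots> = f x + t * s + t * (t * q) / 2" by (simp add: power2_eq_square)
      also have "t * q = - s" using q by (simp add: t_def)
      also have "f x + t * s + t * (- s) / 2 = f x - s\<^sup>2 / (2 * q)"
        by (simp add: t_def power2_eq_square)
      finally have le: "f x' \<le> f x - s\<^sup>2 / (2 * q)" .
      have "(norm d)\<^sup>2 \<le> D\<^sup>2" using dD by (intro power_mono) auto
      then have "q \<le> \<rho> * D\<^sup>2" unfolding q_def using rho by (rule mult_left_mono)
      then have "2 * q * (\<alpha> * h) \<le> 2 * (\<rho> * D\<^sup>2) * (\<alpha> * h)" using \<alpha> h
        by (intro mult_right_mono) auto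
      then have "\<alpha> * h * (2 * q) \<le> s\<^sup>2" using gap' by (simp add: mult_ac)
      then have "\<alpha> * h \<le> s\<^sup>2 / (2 * q)" using q by (simp add: le_divide_eq)
      moreover have "0 < s\<^sup>2 / (2 * q)" using s0 q by simp
      ultimately show ?thesis using le by linarith
    next
      case False
      then have 1: "\<gamma>max = 1" "1 < t" using full by auto
      \<comment> \<open>A forward step cut off at 1: the model value there is below half the slope,
        hence a gain of at least \<open>h / 2\<close>. This is why \<open>\<alpha>\<close> is capped
        at 1/2.\<close>
      have "1 * q < t * q" using 1(2) q by (rule mult_strict_right_mono)
      then have "q < - s" using q by (simp add: t_def)
      moreover have "f x' \<le> f x + s + q / 2" using dec(3)[of 1] 1 by (simp add: s_def q_def)
      ultimately show ?thesis using sh ah h by linarith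
    qed
  qed
  define rep' where "rep' = (if fwd then forward_update p \<gamma> (U, \<mu>) else away_update u \<gamma> (U, \<mu>))"
  have main: "representation_of V rep' x' \<and>
    (card (fst rep') < card U \<or> card (fst rep') \<le> Suc (card U) \<and> f x' \<le> f x - \<alpha> * h)"
  proof (cases fwd)
    case True
    then have "\<gamma>max = 1" by (simp add: gm)
    with progress have pr: "f x' \<le> f x - \<alpha> * h" "f x' < f x" by auto
    \<comment> \<open>Strict decrease rules out the zero step, as the forward update
      requires.\<close>
    then have "\<gamma> \<noteq> 0" by (auto simp: x')
    then have \<gamma>: "0 < \<gamma>" "\<gamma> \<le> 1" using dec(1,2) \<open>\<gamma>max = 1\<close> by auto
    note F = representation_of_forward_update[OF fV repV pV \<gamma>]
    have "card (fst (forward_update p \<gamma> (U, \<mu>))) \<le> card (insert p U)"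
      using F(2) sup(1) by (intro card_mono) auto
    also have "\<dots> \<le> Suc (card U)" by (rule card_insert_le_m1) auto
    finally show ?thesis using F(1) pr True by (simp add: rep'_def x' d)
  next
    case False
    have sU: "1 = \<mu> u + sum \<mu> (U - {u})" using sup(1,3) uU by (simp add: sum.remove)
    \<comment> \<open>If \<open>u\<close> were the only vertex, then \<open>x = u\<close> and the
      forward test would succeed. So \<open>\<mu> u\<close> is below 1 and
      \<open>\<gamma>max\<close> is a genuine quotient.\<close>
    have "U - {u} \<noteq> {}"
    proof
      assume "U - {u} = {}"
      then have "U = {u}" using uU by auto
      then have "x = u" using sup(3,4) by simp
      then show False using False fwd hp h by (simp add: inner_diff_right)
    qed
    then have "0 < sum \<mu> (U - {u})" using sup(1,6) by (intro sum_pos) auto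
    then have "\<mu> u < 1" using sU by simp
    have gm': "\<gamma>max = \<mu> u / (1 - \<mu> u)" using False by (simp add: gm)
    note A = representation_of_away_update[OF fV repV uU \<open>\<mu> u < 1\<close> dec(1) dec(2)[unfolded gm'], folded gm']
    have "card (fst (away_update u \<gamma> (U, \<mu>))) < card U \<or>
      card (fst (away_update u \<gamma> (U, \<mu>))) \<le> Suc (card U) \<and> f x' \<le> f x - \<alpha> * h"
    proof (cases "\<gamma> = \<gamma>max")
      case True
      show ?thesis unfolding A(3)[OF True] using card_Diff1_less[OF sup(1) uU] by blast
    next
      case False
      then have "\<gamma> < \<gamma>max" using dec(2) by simp
      moreover have "card (fst (away_update u \<gamma> (U, \<mu>))) \<le> card U"
        using A(2) sup(1) by (intro card_mono)
      ultimately show ?thesis using progress by simp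
    qed
    then show ?thesis using A(1) False by (simp add: rep'_def x' d)
  qed
  have R': "representation_of V (R rep') x'" "fst (R rep') \<subseteq> fst rep'" "card (fst (R rep')) \<le> N"
    using R main unfolding representation_reduction_def V_def by blast+
  have RU: "R rep' = (U', \<mu>')" using upd by (simp add: rep'_def)
  show "representation_of (vertices X) (U', \<mu>') x'" "card U' \<le> N"
    using R' by (simp_all add: RU V_def)
  have "finite (fst rep')"
    using main representation_of_support(1)[OF fV, of "fst rep'" "snd rep'"] by simp blast
  then have "card U' \<le> card (fst rep')" using R'(2) by (simp add: RU card_mono)
  then show "f x' \<le> f x \<and> card U' < card U \<or> f x' \<le> f x - \<alpha> * h \<and> card U' \<le> Suc (card U)"
    using main ascg_step_nonincreasing[OF grad lip conv step] by linarith
qed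

section \<open>The contraction factor and the convergence rate\<close>

text \<open>Here \<open>W\<close> is the pairwise gap, \<open>r\<close> the distance to an optimal
  point and \<open>n\<close> the bound on the support size. Squaring \<open>gap\<close> and
  inserting the error bound on \<open>r\<close> leaves a common factor \<open>h\<close> that
  cancels.\<close>

lemma contraction_rate_bound:
  fixes h W r n \<Omega> \<rho> \<kappa> D :: real
  assumes h: "0 < h" and \<Omega>: "0 \<le> \<Omega>" and gap: "\<Omega> * h \<le> n * r * W" and r: "r\<^sup>2 \<le> \<kappa> * h"
    and nonneg: "0 \<le> \<rho>" "0 \<le> \<kappa>"
    and \<alpha>: "\<alpha> = min (\<Omega>\<^sup>2 / (8 * \<rho> * \<kappa> * D\<^sup>2 * n\<^sup>2)) (1 / 2)"
  shows "8 * \<rho> * D\<^sup>2 * (\<alpha> * h) \<le> W\<^sup>2"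
proof -
  define K where "K = 8 * \<rho> * \<kappa> * D\<^sup>2 * n\<^sup>2"
  have K0: "0 \<le> K" unfolding K_def using nonneg by (intro mult_nonneg_nonneg) auto
  show ?thesis
  proof (cases "K = 0")
    case True
    \<comment> \<open>With a zero denominator the quotient is 0 by convention, and the claim is
      trivial.\<close>
    then have "\<alpha> = 0" unfolding \<alpha> K_def[symmetric] by simp
    then show ?thesis by simp
  next
    case False
    then have K: "0 < K" using K0 by simp
    have "\<kappa> * n\<^sup>2 \<noteq> 0" using False by (auto simp: K_def)
    then have kn: "0 < \<kappa> * n\<^sup>2" using nonneg by (simp add: less_le)
    have "\<alpha> \<le> \<Omega>\<^sup>2 / K" unfolding \<alpha> K_def by simp
    then have aK: "\<alpha> * K \<le> \<Omega>\<^sup>2" using K by (simp add: le_divide_eq)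
    have "(\<Omega> * h)\<^sup>2 \<le> (n * r * W)\<^sup>2" using gap \<Omega> h by (intro power_mono) auto
    also have "\<dots> = r\<^sup>2 * (n\<^sup>2 * W\<^sup>2)" by (simp add: power_mult_distrib)
    also have "\<dots> \<le> \<kappa> * h * (n\<^sup>2 * W\<^sup>2)" using r by (intro mult_right_mono) auto
    finally have "\<Omega>\<^sup>2 * h * h \<le> W\<^sup>2 * (\<kappa> * n\<^sup>2) * h" by (simp add: power2_eq_square mult_ac)
    then have "\<Omega>\<^sup>2 * h \<le> W\<^sup>2 * (\<kappa> * n\<^sup>2)" using h by simp
    moreover have "\<alpha> * K * h \<le> \<Omega>\<^sup>2 * h" using aK h by (intro mult_right_mono) auto
    ultimately have "8 * \<rho> * D\<^sup>2 * (\<alpha> * h) * (\<kappa> * n\<^sup>2) \<le> W\<^sup>2 * (\<kappa> * n\<^sup>2)"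
      by (simp add: K_def mult_ac)
    then show ?thesis using kn by (rule mult_right_le_imp_le)
  qed
qed

theorem theorem3p1:
  fixes A :: "real^'n^'m" and a :: "real^'m"
    and E :: "real^'n^'q" and b :: "real^'n"
    and g :: "real^'q \<Rightarrow> real" and gradg :: "real^'q \<Rightarrow> real^'q"
    and f :: "real^'n \<Rightarrow> real" and gradf :: "real^'n \<Rightarrow> real^'n"
    and X :: "(real^'n) set"
    and \<sigma>g \<rho> \<theta> D DE G \<Omega> \<kappa> C \<alpha> fopt :: real
    and lmo :: "real^'n \<Rightarrow> real^'n"
    and R :: "(real^'n) set \<times> (real^'n \<Rightarrow> real) \<Rightarrow> (real^'n) set \<times> (real^'n \<Rightarrow> real)"
    and N k :: nat
    and x :: "nat \<Rightarrow> real^'n" and U :: "nat \<Rightarrow> (real^'n) set" and \<mu> :: "nat \<Rightarrow> real^'n \<Rightarrow> real"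
  assumes X_eq: "X = polyhedron_of A a"
    and X_nonempty: "X \<noteq> {}"
    and X_compact: "compact X"
    and g_C1: "C1_with_gradient g gradg"
    and g_strong: "strongly_convex \<sigma>g g"
    and f_eq: "f = (\<lambda>y. g (E *v y) + b \<bullet> y)"
    and f_C1: "C1_with_gradient f gradf"
    and f_lipschitz: "\<rho>-lipschitz_on UNIV gradf"
    and fopt_eq: "fopt = (INF y\<in>X. f y)"
    and D_eq: "D = diameter X"
    and DE_eq: "DE = diameter ((*v) E ` X)"
    and G_eq: "G = (SUP y\<in>X. norm (gradg (E *v y)))"
    and hoffman: "hoffman_constant A a (append_row E b) \<theta>"
    and \<Omega>_eq: "\<Omega> = vertex_facet_distance A a"
    and lmo: "vertex_linear_oracle X lmo"
    and R: "representation_reduction (vertices X) R N"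
    and ascg: "ascg_sequence X f gradf \<rho> lmo R x U \<mu>"
    and \<kappa>_eq: "\<kappa> = \<theta>\<^sup>2 * (norm b * D + 3 * G * DE + 2 * (G\<^sup>2 + 1) / \<sigma>g)"
    and C_eq: "C = G * DE + norm b * D"
    and \<alpha>_eq: "\<alpha> = min (\<Omega>\<^sup>2 / (8 * \<rho> * \<kappa> * D\<^sup>2 * (real N)\<^sup>2)) (1 / 2)"
    and k: "1 \<le> k"
  shows "f (x k) - fopt \<le> C * (1 - \<alpha>) powr ((real k - 1) / 2)"
proof -
  define V where "V = vertices X"
  have fV: "finite V" unfolding V_def X_eq by (rule finite_vertices_polyhedron_of)
  have VX: "V \<subseteq> X" unfolding V_def by (rule vertices_subset)
  have cX: "convex X" unfolding X_eq using polyhedron_polyhedron_of polyhedron_imp_convex by blast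
  have gg: "GDERIV g z :> gradg z" for z using g_C1 by (simp add: C1_with_gradient_def)
  have gf: "GDERIV f z :> gradf z" for z using f_C1 by (simp add: C1_with_gradient_def)
  have contf: "continuous_on X f"
    using gf unfolding gderiv_def
    by (intro continuous_at_imp_continuous_on ballI has_derivative_continuous)
  obtain xs where xs: "xs \<in> X" and opt: "\<And>w. w \<in> X \<Longrightarrow> f xs \<le> f w"
    using continuous_attains_inf[OF X_compact X_nonempty contf] by blast
  have fopt: "fopt = f xs" unfolding fopt_eq using xs opt by (intro cInf_eq_minimum) auto
  have diam: "norm (y - z) \<le> D" if "y \<in> X" "z \<in> X" for y z
    using diameter_bounded_bound[OF compact_imp_bounded[OF X_compact] that] by (simp add: D_eq dist_norm)
  have contE: "continuous_on X ((*v) E)" by (rule matrix_vector_mult_linear_continuous_on)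
  have diamE: "norm (E *v y - E *v z) \<le> DE" if "y \<in> X" "z \<in> X" for y z
    using diameter_bounded_bound[OF compact_imp_bounded[OF compact_continuous_image[OF contE X_compact]]] that
    by (simp add: DE_eq dist_norm)
  have "continuous_on UNIV gradg" using g_C1 by (simp add: C1_with_gradient_def)
  then have "continuous_on X (\<lambda>y. norm (gradg (E *v y)))"
    by (rule continuous_on_norm[OF continuous_on_compose2[OF _ contE subset_UNIV]])
  then have "bdd_above ((\<lambda>y. norm (gradg (E *v y))) ` X)"
    by (rule bounded_imp_bdd_above[OF compact_imp_bounded[OF compact_continuous_image[OF _ X_compact]]])
  then have Gb: "norm (gradg (E *v y)) \<le> G" if "y \<in> X" for y
    unfolding G_eq using that by (intro cSUP_upper)
  have \<sigma>: "0 < \<sigma>g" using g_strong by (simp add: strongly_convex_def)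
  have nonneg: "0 \<le> D" "0 \<le> DE" "0 \<le> G"
    using diam[OF xs xs] diamE[OF xs xs] order_trans[OF norm_ge_zero Gb[OF xs]] by auto
  have \<kappa>0: "0 \<le> \<kappa>" unfolding \<kappa>_eq using nonneg \<sigma> by (intro mult_nonneg_nonneg add_nonneg_nonneg) auto
  have C0: "0 \<le> C" unfolding C_eq using nonneg by simp
  have \<rho>0: "0 \<le> \<rho>" using f_lipschitz by (rule lipschitz_on_nonneg)
  have \<alpha>: "0 \<le> \<alpha>" "\<alpha> \<le> 1 / 2" unfolding \<alpha>_eq using \<rho>0 \<kappa>0 by auto
  have sc: "f (y + t *\<^sub>R (z - y)) \<le> f y + t * (f z - f y) - t * (1 - t) * (\<sigma>g / 2 * (norm (E *v z - E *v y))\<^sup>2)"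
    if "0 \<le> t" "t \<le> 1" for y z t
    using that by (rule composite_strong_convexity[OF g_strong f_eq])
  have conv: "convex_on UNIV f"
  proof (rule convex_onI)
    fix t :: real and y z :: "real^'n" assume t: "0 < t" "t < 1"
    have "0 \<le> t * (1 - t) * (\<sigma>g / 2 * (norm (E *v z - E *v y))\<^sup>2)" using t \<sigma> by simp
    with sc[of t y z] t have "f (y + t *\<^sub>R (z - y)) \<le> f y + t * (f z - f y)" by linarith
    then show "f ((1 - t) *\<^sub>R y + t *\<^sub>R z) \<le> (1 - t) * f y + t * f z"
      by (simp add: algebra_simps)
  qed simp
  have fo: "f y - f z \<le> gradf y \<bullet> (y - z)" for y z
  proof -
    have "gradf y \<bullet> (z - y) + \<sigma>g / 2 * (norm (E *v z - E *v y))\<^sup>2 \<le> f z - f y"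
      by (rule strong_convexity_first_order[OF gf sc])
    moreover have "0 \<le> \<sigma>g / 2 * (norm (E *v z - E *v y))\<^sup>2" using \<sigma> by simp
    ultimately show ?thesis by (simp add: inner_diff_right)
  qed
  \<comment> \<open>This bounds the gap at the starting vertex, where the induction begins with the
    constant \<open>C\<close>.\<close>
  have Cb: "f y - fopt \<le> C" if y: "y \<in> X" for y
  proof -
    have "gradf y \<bullet> (y - xs) = gradg (E *v y) \<bullet> (E *v y - E *v xs) + b \<bullet> (y - xs)"
      using composite_gradient[OF gg, where E = E and x = y and b = b and d = "y - xs"] gf[of y]
      by (simp add: f_eq matrix_vector_mult_diff_distrib)
    also have "gradg (E *v y) \<bullet> (E *v y - E *v xs) \<le> norm (gradg (E *v y)) * norm (E *v y - E *v xs)"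
      by (rule norm_cauchy_schwarz)
    also have "\<dots> \<le> G * DE" using Gb diamE y xs nonneg by (intro mult_mono) auto
    also have "b \<bullet> (y - xs) \<le> norm b * norm (y - xs)" by (rule norm_cauchy_schwarz)
    also have "\<dots> \<le> norm b * D" using diam y xs by (intro mult_left_mono) auto
    finally show ?thesis using fo[of y xs] by (simp add: fopt C_eq)
  qed
  have lmo_min: "gradf y \<bullet> lmo (gradf y) \<le> gradf y \<bullet> z" if "z \<in> X" for y z
    using lmo that by (simp add: vertex_linear_oracle_def)
  have gap: "8 * \<rho> * D\<^sup>2 * (\<alpha> * (f y - fopt)) \<le> (gradf y \<bullet> (u - lmo (gradf y)))\<^sup>2"
    if rep: "representation_of V (W, \<nu>) y" and card: "card W \<le> N" and pos: "0 < f y - fopt"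
      and u: "u \<in> W" "\<And>v. v \<in> W \<Longrightarrow> gradf y \<bullet> v \<le> gradf y \<bullet> u" for W \<nu> y u
  proof -
    let ?w = "gradf y \<bullet> (u - lmo (gradf y))"
    have yX: "y \<in> X" by (rule representation_of_mem[OF fV rep VX cX])
    have "u \<in> X" using u(1) representation_of_support(2)[OF fV rep] VX by blast
    then have w0: "0 \<le> ?w" using lmo_min by (simp add: inner_diff_right)
    obtain z where z: "z \<in> X" "f z = f xs" "(norm (y - z))\<^sup>2 \<le> \<kappa> * (f y - fopt)"
      unfolding \<kappa>_eq fopt X_eq
      by (rule hoffman_error_bound[OF hoffman gg g_strong f_eq gf, of xs y D DE G])
        (use xs opt yX diam diamE Gb X_eq in auto)
    have le: "f y - fopt \<le> gradf y \<bullet> (y - z)" using fo[of y z] z by (simp add: fopt)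
    then have "0 < gradf y \<bullet> (y - z)" using pos by simp
    note G = vertex_facet_gap[OF rep[unfolded V_def X_eq] z(1)[unfolded X_eq] lmo_min[unfolded X_eq] u(2) this,
        folded \<Omega>_eq]
    have "\<Omega> * (f y - fopt) \<le> \<Omega> * (gradf y \<bullet> (y - z))" using le G(1) by (rule mult_left_mono)
    also have "\<dots> \<le> real (card W) * norm (y - z) * ?w" by (rule G(2))
    also have "\<dots> \<le> real N * norm (y - z) * ?w" using card w0 by (intro mult_right_mono) auto
    finally show ?thesis
      using contraction_rate_bound[OF pos G(1) _ z(3) \<rho>0 \<kappa>0 \<alpha>_eq] by blast
  qed
  define q where "q = 1 - \<alpha>"
  have q: "0 < q" "q \<le> 1" using \<alpha> by (auto simp: q_def)
  \<comment> \<open>At an optimal point a forward step of length 0 may put a vertex of weight 0 into \<open>U\<close>, after which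
    \<open>U\<close> and \<open>\<mu>\<close> are arbitrary and the iterates may leave \<open>X\<close>; only monotonicity of \<open>f\<close> survives,
    hence the first disjunct. In the second, \<open>real (card (U j))\<close> in the exponent
    counts the vertices still available for drop steps.\<close>
  define inv where "inv j \<longleftrightarrow> f (x j) \<le> fopt \<or> representation_of V (U j, \<mu> j) (x j) \<and> card (U j) \<le> N \<and>
    f (x j) - fopt \<le> C * q powr ((real j + real (card (U j)) - 2) / 2)" for j
  have "inv k"
    using k
  proof (induction k rule: nat_induct_at_least)
    case base
    have init: "x 1 \<in> V" "\<mu> 1 (x 1) = 1" "\<forall>v\<in>V - {x 1}. \<mu> 1 v = 0" "U 1 = {x 1}"
      using ascg by (auto simp: ascg_sequence_def V_def)
    then have \<mu>1: "\<mu> 1 v = (if v = x 1 then 1 else 0)" if "v \<in> V" for v using that by auto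
    have "sum (\<mu> 1) V = 1" using \<mu>1 init(1) fV by simp
    moreover have "(\<Sum>v\<in>V. \<mu> 1 v *\<^sub>R v) = (\<Sum>v\<in>V. if v = x 1 then v else 0)"
      using \<mu>1 by (intro sum.cong) auto
    ultimately have rep: "representation_of V (U 1, \<mu> 1) (x 1)"
      using \<mu>1 init(1,4) fV by (auto simp: representation_of_def)
    \<comment> \<open>The algorithm does not reduce its initial representation; applying
      \<open>R\<close> to it here only shows that \<open>N\<close> is at least 1, so that the single
      initial vertex respects the size bound. The exponent at \<open>j = 1\<close> is 0.\<close>
    then have "representation_of V (R (U 1, \<mu> 1)) (x 1)" "card (fst (R (U 1, \<mu> 1))) \<le> N"
      using R unfolding representation_reduction_def V_def by blast+
    moreover from this(1) have "finite (fst (R (U 1, \<mu> 1)))" "fst (R (U 1, \<mu> 1)) \<noteq> {}"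
      using representation_of_support(1,5)[OF fV, of "fst (R (U 1, \<mu> 1))" "snd (R (U 1, \<mu> 1))"] by auto
    ultimately have "1 \<le> N" by (metis card_gt_0_iff less_le_trans less_one not_less)
    moreover have "f (x 1) - fopt \<le> C" using Cb init(1) VX by blast
    ultimately show ?case using rep q by (simp add: inv_def init(4) del: One_nat_def)
  next
    case (Suc j)
    have step: "ascg_step f gradf \<rho> lmo R (x j) (U j) (\<mu> j) (x (Suc j)) (U (Suc j)) (\<mu> (Suc j))"
      using ascg Suc.hyps by (simp add: ascg_sequence_def)
    show ?case
    proof (cases "f (x j) \<le> fopt")
      case True
      then show ?thesis
        using ascg_step_nonincreasing[OF gf f_lipschitz conv step] by (auto simp: inv_def)
    next
      case False
      then have h: "0 < f (x j) - fopt" (is "0 < ?h") by simp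
      with Suc.IH have rep: "representation_of V (U j, \<mu> j) (x j)" and card: "card (U j) \<le> N"
        and IH: "?h \<le> C * q powr ((real j + real (card (U j)) - 2) / 2)" (is "_ \<le> C * q powr ?e")
        by (auto simp: inv_def)
      have xX: "x j \<in> X" by (rule representation_of_mem[OF fV rep VX cX])
      have hl: "?h \<le> gradf (x j) \<bullet> (x j - lmo (gradf (x j)))"
        using fo[of "x j" xs] lmo_min[OF xs, of "x j"] by (simp add: fopt inner_diff_right)
      note prog = ascg_step_progress[OF gf f_lipschitz conv cX fV[unfolded V_def] diam lmo R
          rep[unfolded V_def] step h hl \<alpha> gap[OF rep card h], folded V_def]
      let ?e' = "(real (Suc j) + real (card (U (Suc j))) - 2) / 2"
      have "f (x (Suc j)) - fopt \<le> C * q powr ?e'"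
        using prog(3)
      proof
        \<comment> \<open>The index grows by one while the support loses at least one vertex, so the
          exponent does not grow.\<close>
        assume a: "f (x (Suc j)) \<le> f (x j) \<and> card (U (Suc j)) < card (U j)"
        then have "q powr ?e \<le> q powr ?e'" using q by (intro powr_mono') auto
        then have "C * q powr ?e \<le> C * q powr ?e'" using C0 by (rule mult_left_mono)
        then show ?thesis using IH a by linarith
      next
        \<comment> \<open>Index and support size together grow by at most 2, so the exponent grows
          by at most 1, which the contraction factor \<open>q\<close> pays for.\<close>
        assume a: "f (x (Suc j)) \<le> f (x j) - \<alpha> * ?h \<and> card (U (Suc j)) \<le> Suc (card (U j))"
        then have "q powr (?e + 1) \<le> q powr ?e'" using q by (intro powr_mono') (auto simp: field_simps)
        then have "C * q powr (?e + 1) \<le> C * q powr ?e'" using C0 by (rule mult_left_mono)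
        moreover have "q * ?h \<le> q * (C * q powr ?e)" using IH q by (intro mult_left_mono) auto
        moreover have "q * (C * q powr ?e) = C * q powr (?e + 1)" using q by (simp add: powr_add)
        moreover have "f (x (Suc j)) - fopt \<le> q * ?h" using a by (simp add: q_def algebra_simps)
        ultimately show ?thesis by linarith
      qed
      then show ?thesis using prog(1,2) unfolding inv_def by blast
    qed
  qed
  then consider "f (x k) \<le> fopt" | "representation_of V (U k, \<mu> k) (x k)"
    "f (x k) - fopt \<le> C * q powr ((real k + real (card (U k)) - 2) / 2)"
    unfolding inv_def by blast
  then have "f (x k) - fopt \<le> C * q powr ((real k - 1) / 2)"
  proof cases
    case 1
    have "0 \<le> C * q powr ((real k - 1) / 2)" using C0 by simp
    then show ?thesis using 1 by linarith
  next
    case 2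
    have "finite (U k)" "U k \<noteq> {}" using representation_of_support(1,5)[OF fV 2(1)] by auto
    \<comment> \<open>A support of at least one vertex turns the \<open>- 2\<close> in the exponent
      into the claimed \<open>- 1\<close>.\<close>
    then have "1 \<le> card (U k)" by (simp add: Suc_le_eq card_gt_0_iff)
    then have "q powr ((real k + real (card (U k)) - 2) / 2) \<le> q powr ((real k - 1) / 2)"
      using q by (intro powr_mono') auto
    then have "C * q powr ((real k + real (card (U k)) - 2) / 2) \<le> C * q powr ((real k - 1) / 2)"
      using C0 by (rule mult_left_mono)
    then show ?thesis using 2(2) by linarith
  qed
  then show ?thesis by (simp add: q_def)
qed

end
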